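(* Let $k \ge 2$ be an integer. For a real number $H \ge 2$ let $S_k(H)$ denote the number of pairs of positive integers $(x_1, x_2)$ with $x_1 \le H$, $x_2 \le H$ such that the product $x_1 x_2$ is a $k$-th power of a natural number. Then \[ S_k(H) = c_k H^{2/k} (\log H)^{k-1} + O\left( H^{2/k} (\log H)^{k-2} \right), \] where the implied constant depends only on $k$, and \[ c_k = \frac{\mathcal P_k}{\left( (k-1)! \right)^2} \left( 1 + \frac{1}{k^{k-2}} \sum_{k/2 < m \le k-1} \frac{(-1)^{k-m} \, (2m-k)^{k-1} \binom{k-1}{m}}{k-m} \right), \qquad \mathcal P_k = \prod_{p} \left( 1 - \frac{1}{p} \right)^{k-1} \left( 1 + \frac{k-1}{p} \right), \] the sum in $c_k$ being over integers $m$ with $k/2 < m \le k-1$ and the product over all primes $p$.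
   Context: An empty sum equals $0$ (so for $k=2$ the sum over $m$ is empty). The asymptotic formula is understood as $H \to \infty$. *)

theory Defs
  imports
    "HOL-Analysis.Analysis"
    "HOL-Computational_Algebra.Nth_Powers"
    "HOL-Library.Landau_Symbols"
begin

definition power_pair_count :: "nat \<Rightarrow> real \<Rightarrow> nat" where
  "power_pair_count k H =
     card {(x1, x2). 0 < x1 \<and> real x1 \<le> H \<and> 0 < x2 \<and> real x2 \<le> H \<and> is_nth_power k (x1 * x2)}"

definition euler_const :: "nat \<Rightarrow> real" where
  "euler_const k =
     (\<Prod>p. if prime p then (1 - 1 / real p) ^ (k - 1) * (1 + (real k - 1) / real p) else 1)"

definition main_const :: "nat \<Rightarrow> real" where
  "main_const k =
     euler_const k / (fact (k - 1)) ^ 2 *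
     (1 + 1 / real k ^ (k - 2) *
        (\<Sum>m | real k / 2 < real m \<and> m \<le> k - 1.
           (-1) ^ (k - m) * (2 * real m - real k) ^ (k - 1) * real ((k - 1) choose m)
             / (real k - real m)))"

end

theory Submission
  imports Defs "HOL-Computational_Algebra.Squarefree"
begin

text \<open>
  Write \<open>x\<^sub>1 = \<Prod> a\<^sub>i\<^sup>i \<cdot> c\<^sup>k\<close> and \<open>x\<^sub>2 = \<Prod> a\<^sub>i\<^sup>k\<^sup>-\<^sup>i \<cdot> d\<^sup>k\<close> with \<open>1 \<le> i < k\<close> and \<open>\<Prod> a\<^sub>i\<close> squarefree; this
  parametrises the pairs whose product is a \<open>k\<close>-th power, so up to a boundary term the count is
  \<open>H\<close> to the power \<open>2/k\<close> times the sum of \<open>1 / \<Prod> a\<^sub>i\<close> over squarefree tuples with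
  \<open>\<Sum> i ln a\<^sub>i \<le> ln H\<close> and \<open>\<Sum> (k - i) ln a\<^sub>i \<le> ln H\<close>. Without the squarefreeness condition this sum is
  the volume of a polytope with an error smaller by one factor of \<open>ln H\<close>. Imposing the condition
  one prime \<open>p\<close> at a time multiplies the main term by an Euler factor, while the error grows only by
  a factor
  \<open>1 + O(ln p / p\<^sup>2)\<close>, because the terms of order \<open>1/p\<close> cancel. The volume is a divided difference of
  truncated powers (a cardinal B-spline), which yields the closed form of the constant.
\<close>

text \<open>With \<open>L = ln H\<close>, the main term carries \<open>L ^ (k - 1)\<close> and only
  \<open>L ^ (k - 2)\<close> may be lost, so every estimate has to save exactly one power of
  \<open>L\<close>. Dividing a coordinate \<open>i\<close> by a prime \<open>p\<close> lowers the
  two bounds by \<open>i * ln p\<close> and \<open>(k - i) * ln p\<close>. Hence the intermediate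
  estimates are stated for arbitrary \<alpha>, \<beta> \<le> \<open>L\<close>, although only
  \<alpha> = \<beta> = \<open>ln H\<close> matters in the end. Such a move changes the volume by
  \<open>O(ln p * L ^ (k - 2))\<close>, which is the source of the \<open>ln p\<close>. The delicate
  point is uniformity in the number of primes: factors \<open>1 + O(1/p)\<close> in the error would
  have a divergent product, whereas the product of \<open>1 + O(ln p / p^2)\<close> stays bounded,
  so that one constant survives the passage to the infinite Euler product. The volume enters through
  its spline formula and not as a measure: adding a coordinate then is a one-dimensional
  integration, and both the Lipschitz bound and the value on the diagonal can be read off the
  formula.\<close>

section \<open>Volume of the polytope\<close>

text \<open>\<open>\<Sum>j\<in>N. dd_weight N j * f j\<close> is, up to sign, the divided difference of \<open>f\<close> at the nodes \<open>N\<close>.\<close>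

definition dd_weight :: "nat set \<Rightarrow> nat \<Rightarrow> real" where
  "dd_weight N j = (\<Prod>l\<in>N - {j}. 1 / (real l - real j))"

lemma dd_weight_insert:
  assumes "finite N" "i \<notin> N" "j \<in> N"
  shows "dd_weight (insert i N) j = dd_weight N j / (real i - real j)"
proof -
  have "insert i N - {j} = insert i (N - {j})" using assms by auto
  then show ?thesis using assms by (simp add: dd_weight_def)
qed

text \<open>This is the partial fraction expansion of the product on the right as a function of
  \<open>x\<close>; up to sign the weights are its residues. It is needed at a point
  \<open>x\<close> that is about to become a node.\<close>

lemma sum_dd_weight_div:
  assumes "finite N" "N \<noteq> {}" "x \<notin> real ` N"
  shows "(\<Sum>j\<in>N. dd_weight N j / (x - real j)) = - (\<Prod>l\<in>N. 1 / (real l - x))"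
  using assms
proof (induction N arbitrary: x rule: finite_ne_induct)
  case (singleton i)
  then show ?case by (simp add: dd_weight_def minus_divide_right)
next
  case (insert i N)
  have xi: "x \<noteq> real i" and xN: "x \<notin> real ` N" using insert.prems by auto
  have iN: "real i \<notin> real ` N" using insert by auto
  have partfrac: "w / a / b = (w / a - w / b) / (b - a)" if "a \<noteq> 0" "b \<noteq> 0" "b \<noteq> a" for a b w :: real
    using that by (simp add: field_simps)
  have *: "(\<Sum>j\<in>N. dd_weight (insert i N) j / (x - real j))
     = (\<Sum>j\<in>N. dd_weight N j / (real i - real j) - dd_weight N j / (x - real j)) / (x - real i)"
    unfolding sum_divide_distrib
  proof (rule sum.cong[OF refl])
    fix j assume j: "j \<in> N"
    have "real i \<noteq> real j" "x \<noteq> real j" using j iN xN by auto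
    then show "dd_weight (insert i N) j / (x - real j)
      = (dd_weight N j / (real i - real j) - dd_weight N j / (x - real j)) / (x - real i)"
      using partfrac[of "real i - real j" "x - real j" "dd_weight N j"] xi j insert.hyps
      by (simp add: dd_weight_insert)
  qed
  have wi: "dd_weight (insert i N) i = (\<Prod>l\<in>N. 1 / (real l - real i))"
    using insert by (simp add: dd_weight_def)
  have fin: "P / d + (Q - P) / d = - (Q / (- d))" if "d \<noteq> 0" for P Q d :: real
    using that by (simp add: field_simps)
  show ?case
    using insert.hyps fin[of "x - real i" "\<Prod>l\<in>N. 1 / (real l - real i)" "\<Prod>l\<in>N. 1 / (real l - x)"] xi
    by (simp add: * sum_subtractf insert.IH[OF iN] insert.IH[OF xN] wi)
qed

text \<open>Equivalently, the weights of the enlarged node set sum to zero, as they must for a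
  divided difference to annihilate constants.\<close>

lemma dd_weight_new:
  assumes "finite N" "N \<noteq> {}" "i \<notin> N"
  shows "dd_weight (insert i N) i = - (\<Sum>j\<in>N. dd_weight N j / (real i - real j))"
proof -
  have "real i \<notin> real ` N" using assms by auto
  from sum_dd_weight_div[OF assms(1,2) this] show ?thesis
    using assms by (simp add: dd_weight_def)
qed

text \<open>For \<open>n \<ge> 1\<close> the function \<open>max 0 x ^ Suc n\<close> is
  differentiable even at its knot, so one antiderivative serves across the point where the
  truncation sets in. The sign of \<open>c\<close> is left open, since a new node has old nodes on
  both sides.\<close>

lemma has_integral_pos_power:
  fixes y c s :: real
  assumes "c \<noteq> 0" "s \<ge> 0" "n \<ge> 1"
  shows "((\<lambda>u. max 0 (y - c * u) ^ n) has_integral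
           (max 0 y ^ Suc n - max 0 (y - c * s) ^ Suc n) / (real (Suc n) * c)) {0..s}"
proof -
  have D: "((\<lambda>x::real. max 0 x ^ Suc n) has_real_derivative real (Suc n) * max 0 x ^ n) (at x)" for x
  proof (cases "x = 0")
    case False
    then consider "x > 0" | "x < 0" by linarith
    then show ?thesis
    proof cases
      case 1
      have "((\<lambda>x::real. x ^ Suc n) has_real_derivative real (Suc n) * x ^ n) (at x)"
        by (rule derivative_eq_intros refl | simp)+
      then have "((\<lambda>x::real. max 0 x ^ Suc n) has_real_derivative real (Suc n) * x ^ n) (at x)"
        by (rule has_field_derivative_transform_within_open[where S="{0<..}"]) (use 1 in auto)
      then show ?thesis using 1 by simp
    next
      case 2
      have "((\<lambda>x::real. 0) has_real_derivative 0) (at x)" by simp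
      then have "((\<lambda>x::real. max 0 x ^ Suc n) has_real_derivative 0) (at x)"
        by (rule has_field_derivative_transform_within_open[where S="{..<0}"]) (use 2 in auto)
      then show ?thesis using 2 assms by (simp add: power_0_left del: power_Suc)
    qed
  next
    case True
    have "((\<lambda>h::real. max 0 h ^ n) \<longlongrightarrow> max 0 0 ^ n) (at 0)"
      by (intro tendsto_intros)
    then have t: "((\<lambda>h::real. max 0 h ^ n) \<longlongrightarrow> 0) (at 0)" using assms by (simp add: power_0_left)
    have "((\<lambda>h::real. (max 0 (0 + h) ^ Suc n - max 0 0 ^ Suc n) / h) \<longlongrightarrow> 0) (at 0)"
    proof (rule Lim_null_comparison[OF _ t])
      show "\<forall>\<^sub>F h in at 0. norm ((max 0 (0 + h) ^ Suc n - max 0 0 ^ Suc n) / h :: real) \<le> max 0 h ^ n"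
      proof (rule always_eventually, rule allI)
        fix h :: real
        show "norm ((max 0 (0 + h) ^ Suc n - max 0 0 ^ Suc n) / h) \<le> max 0 h ^ n"
          by (cases "h > 0") (auto simp: max_def)
      qed
    qed
    then show ?thesis using True assms unfolding DERIV_def by (simp add: power_0_left)
  qed
  define G where "G = (\<lambda>u. - (max 0 (y - c * u) ^ Suc n) / (real (Suc n) * c))"
  have "(G has_real_derivative max 0 (y - c * u) ^ n) (at u)" for u
  proof -
    have "((\<lambda>u. max 0 (y - c * u) ^ Suc n) has_real_derivative
            real (Suc n) * max 0 (y - c * u) ^ n * (0 - c * 1)) (at u)"
      by (rule DERIV_chain'[OF _ D]) (auto intro!: derivative_eq_intros)
    from DERIV_cdivide[OF DERIV_minus[OF this], of "real (Suc n) * c"]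
    show ?thesis unfolding G_def using assms by simp
  qed
  then have "((\<lambda>u. max 0 (y - c * u) ^ n) has_integral (G s - G 0)) {0..s}"
    by (intro fundamental_theorem_of_calculus)
      (use assms in \<open>auto simp: has_real_derivative_iff_has_vector_derivative[symmetric]
        intro: has_field_derivative_at_within\<close>)
  moreover have "G s - G 0 = (max 0 y ^ Suc n - max 0 (y - c * s) ^ Suc n) / (real (Suc n) * c)"
    by (simp add: G_def diff_divide_distrib)
  ultimately show ?thesis by simp
qed

text \<open>
  For \<open>\<alpha>, \<beta> \<ge> 0\<close> this is the volume of \<open>{u \<ge> 0. (\<Sum>i\<in>I. i u\<^sub>i) \<le> \<alpha> \<and> (\<Sum>i\<in>I. (k - i) u\<^sub>i) \<le> \<beta>}\<close>: the two
  inequalities contribute slack variables with the nodes \<open>0\<close> and \<open>k\<close>, and integrating out the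
  coordinate \<open>i\<close> adds the node \<open>i\<close>.
\<close>

definition spline :: "nat \<Rightarrow> nat set \<Rightarrow> real \<Rightarrow> real \<Rightarrow> real" where
  "spline k I \<alpha> \<beta> = real k / fact (card I) *
     (\<Sum>j\<in>insert 0 (insert k I). dd_weight (insert 0 (insert k I)) j *
        max 0 (\<alpha> - real j * ((\<alpha> + \<beta>) / real k)) ^ card I)"

text \<open>The total \<alpha> + \<beta> shrinks by \<open>k * u\<close>, and the integration stops
  where it reaches 0. At that endpoint the arguments of all truncated powers coincide with the one
  belonging to the node \<open>i\<close>; by \<open>dd_weight_new\<close> these equal contributions
  merge into the summand of the new node.\<close>

lemma spline_insert:
  assumes "finite I" "I \<noteq> {}" "i \<notin> I" "insert i I \<subseteq> {1..<k}" "\<alpha> + \<beta> \<ge> 0"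
  shows "((\<lambda>u. spline k I (\<alpha> - real i * u) (\<beta> - (real k - real i) * u)) has_integral
           spline k (insert i I) \<alpha> \<beta>) {0..(\<alpha> + \<beta>) / real k}"
proof -
  define N where "N = insert 0 (insert k I)"
  define s where "s = (\<alpha> + \<beta>) / real k"
  define n where "n = card I"
  define y where "y = (\<lambda>j::nat. \<alpha> - real j * s)"
  have k0: "k > 0" using assms by auto
  have s0: "s \<ge> 0" using assms by (simp add: s_def)
  have n1: "n \<ge> 1" using assms by (simp add: n_def card_gt_0_iff Suc_le_eq)
  have fN: "finite N" "N \<noteq> {}" using assms by (auto simp: N_def)
  have iN: "i \<notin> N" using assms by (auto simp: N_def)
  have ij: "real i - real j \<noteq> 0" if "j \<in> N" for j using that iN by auto
  have N': "insert 0 (insert k (insert i I)) = insert i N" by (auto simp: N_def)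
  have ci: "card (insert i I) = Suc n" using assms by (simp add: n_def)
  have eq: "spline k I (\<alpha> - real i * u) (\<beta> - (real k - real i) * u) =
      real k / fact n * (\<Sum>j\<in>N. dd_weight N j * max 0 (y j - (real i - real j) * u) ^ n)" for u
  proof -
    have "((\<alpha> - real i * u) + (\<beta> - (real k - real i) * u)) / real k = s - u"
      using k0 by (simp add: s_def field_simps)
    then have "(\<alpha> - real i * u) - real j * (((\<alpha> - real i * u) + (\<beta> - (real k - real i) * u)) / real k)
        = y j - (real i - real j) * u" for j
      by (simp only:) (simp add: y_def algebra_simps)
    then show ?thesis unfolding spline_def N_def[symmetric] n_def[symmetric] by simp
  qed
  have "((\<lambda>u. real k / fact n * (\<Sum>j\<in>N. dd_weight N j * max 0 (y j - (real i - real j) * u) ^ n))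
     has_integral (real k / fact n * (\<Sum>j\<in>N. dd_weight N j *
       ((max 0 (y j) ^ Suc n - max 0 (y j - (real i - real j) * s) ^ Suc n) / (real (Suc n) * (real i - real j)))))) {0..s}"
    by (intro has_integral_mult_right has_integral_sum fN has_integral_pos_power ij s0 n1)
  moreover have "y j - (real i - real j) * s = y i" for j by (simp add: y_def algebra_simps)
  moreover have "real k / fact n * (\<Sum>j\<in>N. dd_weight N j *
       ((max 0 (y j) ^ Suc n - max 0 (y i) ^ Suc n) / (real (Suc n) * (real i - real j))))
     = spline k (insert i I) \<alpha> \<beta>"
  proof -
    have "(\<Sum>j\<in>N. dd_weight N j *
       ((max 0 (y j) ^ Suc n - max 0 (y i) ^ Suc n) / (real (Suc n) * (real i - real j))))
      = (\<Sum>j\<in>N. (dd_weight N j / (real i - real j)) * max 0 (y j) ^ Suc n / real (Suc n)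
           - (dd_weight N j / (real i - real j)) * (max 0 (y i) ^ Suc n / real (Suc n)))"
    proof (rule sum.cong[OF refl])
      fix j assume "j \<in> N"
      have "w * ((A - B) / (m * d)) = w / d * A / m - w / d * (B / m)" for w A B m d :: real
        by (cases "m = 0 \<or> d = 0") (auto simp: field_simps)
      then show "dd_weight N j * ((max 0 (y j) ^ Suc n - max 0 (y i) ^ Suc n) / (real (Suc n) * (real i - real j)))
        = (dd_weight N j / (real i - real j)) * max 0 (y j) ^ Suc n / real (Suc n)
           - (dd_weight N j / (real i - real j)) * (max 0 (y i) ^ Suc n / real (Suc n))" .
    qed
    also have "\<dots> = (\<Sum>j\<in>N. dd_weight (insert i N) j * max 0 (y j) ^ Suc n) / real (Suc n)
        + dd_weight (insert i N) i * (max 0 (y i) ^ Suc n / real (Suc n))"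
      unfolding dd_weight_new[OF fN iN] sum_subtractf sum_distrib_right[symmetric] sum_divide_distrib
      using fN iN by (simp add: dd_weight_insert)
    also have "\<dots> = (\<Sum>j\<in>insert i N. dd_weight (insert i N) j * max 0 (y j) ^ Suc n) / real (Suc n)"
      using fN iN by (simp add: add_divide_distrib)
    finally show ?thesis
      unfolding spline_def N' ci s_def[symmetric] y_def by (simp del: power_Suc)
  qed
  ultimately show ?thesis unfolding eq s_def[symmetric] by simp
qed

text \<open>Base case of the volume interpretation: the polytope is an interval, and the three
  truncated powers of the nodes \<open>0\<close>, \<open>k\<close>, \<open>i\<close> must collapse
  to its length.\<close>

lemma spline_singleton:
  assumes "0 < i" "i < k" "\<alpha> + \<beta> \<ge> 0"
  shows "spline k {i} \<alpha> \<beta> = max 0 (min (\<alpha> / real i) (\<beta> / (real k - real i)))"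
proof -
  have e: "{k, i} - {0} = {k,i}" "{0,k,i} - {k} = {0,i}" "{0,k,i} - {i} = {0,k}"
    using assms by auto
  define d where "d = real k - real i"
  have ki: "real k = real i + d" "d > 0" "real i > 0" using assms by (auto simp: d_def)
  have y: "\<alpha> - real i * ((\<alpha> + \<beta>) / (real i + d)) = (d * \<alpha> - real i * \<beta>) / (real i + d)"
    "\<alpha> - (real i + d) * ((\<alpha> + \<beta>) / (real i + d)) = - \<beta>"
    using ki by (simp_all add: field_simps)
  have "spline k {i} \<alpha> \<beta> = real k * (max 0 \<alpha> / (real i * real k) + max 0 (-\<beta>) / (real k * d)
      - max 0 ((d * \<alpha> - real i * \<beta>) / real k) / (real i * d))"
  proof -
    have w: "dd_weight {0,k,i} 0 = 1 / (real i * real k)" "dd_weight {0,k,i} k = 1 / (real k * d)"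
      "dd_weight {0,k,i} i = - 1 / (real i * d)"
      using assms e by (simp_all add: dd_weight_def d_def divide_simps)
    have "(\<Sum>j\<in>{0,k,i}. f j) = f 0 + f k + f i" for f :: "nat \<Rightarrow> real"
      using assms by simp
    then have "spline k {i} \<alpha> \<beta> = real k *
       (1 / (real i * real k) * max 0 \<alpha> + 1 / (real k * d) * max 0 (\<alpha> - (real i + d) * ((\<alpha> + \<beta>) / (real i + d)))
         + (- 1 / (real i * d)) * max 0 (\<alpha> - real i * ((\<alpha> + \<beta>) / (real i + d))))"
      unfolding spline_def by (simp only: w) (simp add: ki(1))
    then show ?thesis unfolding y by (simp add: ki(1))
  qed
  also have "\<dots> = max 0 \<alpha> / real i + max 0 (-\<beta>) / d - max 0 ((d * \<alpha> - real i * \<beta>) / real k) * real k / (real i * d)"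
    using ki(2,3) assms by (simp add: field_simps)
  also have "max 0 ((d * \<alpha> - real i * \<beta>) / real k) * real k = max 0 (d * \<alpha> - real i * \<beta>)"
    using assms(1,2) by (simp add: max_def field_simps)
  also have "max 0 (d * \<alpha> - real i * \<beta>) / (real i * d) = max 0 (\<alpha> / real i - \<beta> / d)"
    using ki by (simp add: max_def field_simps)
  also have "max 0 \<alpha> / real i = max 0 (\<alpha> / real i)" using ki by (simp add: max_def field_simps)
  also have "max 0 (-\<beta>) / d = max 0 (-\<beta> / d)" using ki by (simp add: max_def field_simps)
  \<comment> \<open>This identity of positive parts fails when both quotients are negative, a case
    that \<alpha> + \<beta> \<ge> 0 excludes.\<close>
  also have "max 0 (\<alpha> / real i) + max 0 (-\<beta> / d) - max 0 (\<alpha> / real i - \<beta> / d) = max 0 (min (\<alpha> / real i) (\<beta> / d))"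
  proof -
    have "\<alpha> / real i \<ge> 0 \<or> \<beta> / d \<ge> 0"
      using assms ki by (metis add_neg_neg divide_nonneg_pos linorder_not_le)
    moreover have "max 0 x + max 0 (- z) - max 0 (x - z) = max 0 (min x z)" if "x \<ge> 0 \<or> z \<ge> 0" for x z :: real
      using that by linarith
    ultimately show ?thesis by simp
  qed
  finally show ?thesis by (simp add: d_def)
qed

text \<open>Vanishing outside the quadrant is not visible in the formula. It is inherited through
  the integral: both arguments decrease in \<open>u\<close>, so a nonpositive one stays nonpositive,
  while their sum stays nonnegative on the range of integration.\<close>

lemma spline_eq_0:
  assumes "finite I" "I \<noteq> {}" "I \<subseteq> {1..<k}" "\<alpha> + \<beta> \<ge> 0" "\<alpha> \<le> 0 \<or> \<beta> \<le> 0"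
  shows "spline k I \<alpha> \<beta> = 0"
  using assms
proof (induction I arbitrary: \<alpha> \<beta> rule: finite_ne_induct)
  case (singleton i)
  then have "\<alpha> / real i \<le> 0 \<or> \<beta> / (real k - real i) \<le> 0"
    by (auto simp: divide_nonpos_pos)
  then have "min (\<alpha> / real i) (\<beta> / (real k - real i)) \<le> 0" by (simp only: min_le_iff_disj)
  then show ?case using singleton.prems by (subst spline_singleton) (simp_all only: max.absorb1, auto)
next
  case (insert i I)
  have k0: "real k > 0" "real i \<ge> 0" "real k - real i \<ge> 0" using insert.prems by auto
  have z: "spline k I (\<alpha> - real i * u) (\<beta> - (real k - real i) * u) = 0"
    if u: "u \<in> {0..(\<alpha> + \<beta>) / real k}" for u
  proof (rule insert.IH)
    have "u * real k \<le> \<alpha> + \<beta>" using u k0 by (simp add: field_simps)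
    then show "\<alpha> - real i * u + (\<beta> - (real k - real i) * u) \<ge> 0" by (simp add: algebra_simps)
    have "real i * u \<ge> 0" "(real k - real i) * u \<ge> 0" using u k0 by auto
    then show "\<alpha> - real i * u \<le> 0 \<or> \<beta> - (real k - real i) * u \<le> 0" using insert.prems by linarith
  qed (use insert.prems in auto)
  have "((\<lambda>u. 0) has_integral spline k (insert i I) \<alpha> \<beta>) {0..(\<alpha> + \<beta>) / real k}"
    by (rule has_integral_eq[OF _ spline_insert]) (use insert z in auto)
  then show ?case using has_integral_0 has_integral_unique by blast
qed

text \<open>The spline formula represents the volume only for \<alpha> + \<beta> \<ge> 0 and need
  not vanish when both arguments are negative. Clamping them at 0 gives a function that is correct
  on the whole plane and remains Lipschitz.\<close>

definition vol :: "nat \<Rightarrow> nat set \<Rightarrow> real \<Rightarrow> real \<Rightarrow> real" where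
  "vol k I \<alpha> \<beta> = spline k I (max 0 \<alpha>) (max 0 \<beta>)"

lemma vol_eq_0:
  assumes "finite I" "I \<noteq> {}" "I \<subseteq> {1..<k}" "\<alpha> \<le> 0 \<or> \<beta> \<le> 0"
  shows "vol k I \<alpha> \<beta> = 0"
  unfolding vol_def by (rule spline_eq_0) (use assms in auto)

text \<open>Beyond the natural endpoint one of the two arguments is nonpositive and the integrand is
  0. The upper limit can therefore be chosen independently of \<alpha> and \<beta>, as the
  comparison with a sum over a fixed range requires.\<close>

lemma vol_insert:
  assumes "finite I" "I \<noteq> {}" "i \<notin> I" "insert i I \<subseteq> {1..<k}"
    and U: "U \<ge> 0" "U \<ge> (\<alpha> + \<beta>) / real k"
  shows "((\<lambda>u. vol k I (\<alpha> - real i * u) (\<beta> - (real k - real i) * u)) has_integral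
           vol k (insert i I) \<alpha> \<beta>) {0..U}"
proof (cases "\<alpha> \<ge> 0 \<and> \<beta> \<ge> 0")
  case True
  define s where "s = (\<alpha> + \<beta>) / real k"
  have k0: "real k > 0" "real i \<ge> 0" "real k - real i \<ge> 0" using assms by auto
  have s0: "s \<ge> 0" using True by (simp add: s_def)
  have I: "I \<subseteq> {1..<k}" using assms by auto
  have "((\<lambda>u. spline k I (\<alpha> - real i * u) (\<beta> - (real k - real i) * u)) has_integral
           spline k (insert i I) \<alpha> \<beta>) {0..s}"
    unfolding s_def by (rule spline_insert) (use assms True in auto)
  also have "?this \<longleftrightarrow> ((\<lambda>u. vol k I (\<alpha> - real i * u) (\<beta> - (real k - real i) * u)) has_integral
           vol k (insert i I) \<alpha> \<beta>) {0..s}"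
  proof -
    have "spline k (insert i I) \<alpha> \<beta> = vol k (insert i I) \<alpha> \<beta>"
      using True by (simp add: vol_def max_def)
    moreover have "spline k I (\<alpha> - real i * u) (\<beta> - (real k - real i) * u)
       = vol k I (\<alpha> - real i * u) (\<beta> - (real k - real i) * u)" if u: "u \<in> {0..s}" for u
    proof (cases "\<alpha> - real i * u \<ge> 0 \<and> \<beta> - (real k - real i) * u \<ge> 0")
      case True
      then show ?thesis by (simp add: vol_def max_def)
    next
      case False
      have "u * real k \<le> \<alpha> + \<beta>" using u k0 by (simp add: s_def field_simps)
      then have "\<alpha> - real i * u + (\<beta> - (real k - real i) * u) \<ge> 0" by (simp add: algebra_simps)
      then show ?thesis
        by (subst spline_eq_0[OF assms(1,2) I], simp, use False in linarith,
            subst vol_eq_0[OF assms(1,2) I], use False in auto)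
    qed
    ultimately show ?thesis by (simp only:) (intro has_integral_cong; simp)
  qed
  finally have 1: "((\<lambda>u. vol k I (\<alpha> - real i * u) (\<beta> - (real k - real i) * u)) has_integral
           vol k (insert i I) \<alpha> \<beta>) {0..s}" .
  have "((\<lambda>u. vol k I (\<alpha> - real i * u) (\<beta> - (real k - real i) * u)) has_integral 0) {s..U}"
  proof (rule has_integral_is_0)
    fix u assume u: "u \<in> {s..U}"
    then have "u * real k \<ge> \<alpha> + \<beta>" using k0 by (simp add: s_def field_simps)
    then have "(\<alpha> - real i * u) + (\<beta> - (real k - real i) * u) \<le> 0" by (simp add: algebra_simps)
    then show "vol k I (\<alpha> - real i * u) (\<beta> - (real k - real i) * u) = 0"
      by (intro vol_eq_0 assms I) linarith
  qed
  from has_integral_combine[OF s0 _ 1 this] U show ?thesis by (simp add: s_def)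
next
  case False
  have k0: "real k > 0" "real i \<ge> 0" "real k - real i \<ge> 0" using assms by auto
  have "vol k (insert i I) \<alpha> \<beta> = 0" by (rule vol_eq_0) (use assms False in auto)
  moreover have "((\<lambda>u. vol k I (\<alpha> - real i * u) (\<beta> - (real k - real i) * u)) has_integral 0) {0..U}"
  proof (rule has_integral_is_0)
    fix u assume u: "u \<in> {0..U}"
    have "real i * u \<ge> 0" "(real k - real i) * u \<ge> 0" using u k0 by auto
    then show "vol k I (\<alpha> - real i * u) (\<beta> - (real k - real i) * u) = 0"
      by (intro vol_eq_0) (use assms False in \<open>auto\<close>)
  qed
  ultimately show ?thesis by simp
qed

section \<open>Lipschitz continuity of the volume\<close>

lemma power_diff_le:
  fixes x y :: real
  assumes "0 \<le> x" "x \<le> M" "0 \<le> y" "y \<le> M"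
  shows "\<bar>x ^ n - y ^ n\<bar> \<le> real n * M ^ (n - 1) * \<bar>x - y\<bar>"
proof (induction n)
  case (Suc n)
  have "x ^ Suc n - y ^ Suc n = x * (x ^ n - y ^ n) + (x - y) * y ^ n" by (simp add: algebra_simps)
  also have "\<bar>\<dots>\<bar> \<le> x * \<bar>x ^ n - y ^ n\<bar> + \<bar>x - y\<bar> * y ^ n"
    using assms by (intro order_trans[OF abs_triangle_ineq]) (simp add: abs_mult)
  also have "\<dots> \<le> M * (real n * M ^ (n - 1) * \<bar>x - y\<bar>) + \<bar>x - y\<bar> * M ^ n"
    using assms Suc by (intro add_mono mult_mono power_mono) auto
  also have "M * (real n * M ^ (n - 1) * \<bar>x - y\<bar>) = real n * M ^ n * \<bar>x - y\<bar>"
    by (cases n) (auto simp: mult_ac)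
  finally show ?case by (simp add: algebra_simps)
qed simp

text \<open>A spline of degree \<open>card I\<close> has slope of order
  \<open>L ^ (card I - 1)\<close> on a region bounded by \<open>L\<close>. This is the one analytic
  input of both later steps: it bounds the error of replacing sums by integrals and the effect of
  translating the region by multiples of \<open>ln p\<close>.\<close>

lemma vol_Lipschitz:
  assumes "finite I" "I \<noteq> {}" "I \<subseteq> {1..<k}"
  shows "\<exists>C\<ge>0. \<forall>L\<ge>0. \<forall>\<alpha>\<le>L. \<forall>\<beta>\<le>L. \<forall>\<alpha>'\<le>L. \<forall>\<beta>'\<le>L.
    \<bar>vol k I \<alpha> \<beta> - vol k I \<alpha>' \<beta>'\<bar> \<le> C * (1 + L) ^ (card I - 1) * (\<bar>\<alpha> - \<alpha>'\<bar> + \<bar>\<beta> - \<beta>'\<bar>)"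
proof -
  define N where "N = insert 0 (insert k I)"
  define r where "r = card I"
  define C where "C = real k / fact r * (\<Sum>j\<in>N. \<bar>dd_weight N j\<bar> * real r)"
  have k0: "real k > 0" using assms by auto
  show ?thesis
  proof (intro exI[of _ C] conjI allI impI)
    show "C \<ge> 0" unfolding C_def by (intro mult_nonneg_nonneg sum_nonneg) auto
    fix L \<alpha> \<beta> \<alpha>' \<beta>' :: real
    assume L: "L \<ge> 0" "\<alpha> \<le> L" "\<beta> \<le> L" "\<alpha>' \<le> L" "\<beta>' \<le> L"
    define a b a' b' where ab: "a = max 0 \<alpha>" "b = max 0 \<beta>" "a' = max 0 \<alpha>'" "b' = max 0 \<beta>'"
    define \<delta> where "\<delta> = \<bar>\<alpha> - \<alpha>'\<bar> + \<bar>\<beta> - \<beta>'\<bar>"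
    define M where "M = (1 + L) ^ (r - 1)"
    have rng: "0 \<le> a" "a \<le> L" "0 \<le> b" "b \<le> L" "0 \<le> a'" "a' \<le> L" "0 \<le> b'" "b' \<le> L"
      using L by (auto simp: ab)
    have d: "\<bar>a - a'\<bar> + \<bar>b - b'\<bar> \<le> \<delta>" by (auto simp: ab \<delta>_def max_def)
    have M0: "M \<ge> 0" using L by (simp add: M_def)
    have tm: "\<bar>max 0 (a - real j * ((a + b) / real k)) ^ r - max 0 (a' - real j * ((a' + b') / real k)) ^ r\<bar>
       \<le> real r * M * \<delta>" if j: "j \<in> N" for j
    proof -
      \<comment> \<open>All nodes lie in \<open>[0, k]\<close>, so \<open>t\<close> lies in
        \<open>[0, 1]\<close> and the argument becomes \<open>(1 - t) * a - t * b\<close>, which is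
        at most \<open>L\<close> and varies by no more than the sum of the changes of
        \<open>a\<close> and \<open>b\<close>.\<close>
      define t where "t = real j / real k"
      have t: "0 \<le> t" "t \<le> 1" using j assms k0 by (auto simp: t_def N_def)
      have y: "x - real j * ((x + z) / real k) = (1 - t) * x - t * z" for x z
        using k0 by (simp add: t_def field_simps)
      have conv: "\<bar>(1 - t) * x - t * z\<bar> \<le> \<bar>x\<bar> + \<bar>z\<bar>" for x z
      proof -
        have "\<bar>(1 - t) * x - t * z\<bar> \<le> (1 - t) * \<bar>x\<bar> + t * \<bar>z\<bar>"
          using t by (intro order_trans[OF abs_triangle_ineq4]) (simp add: abs_mult)
        also have "\<dots> \<le> 1 * \<bar>x\<bar> + 1 * \<bar>z\<bar>" using t by (intro add_mono mult_right_mono) auto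
        finally show ?thesis by simp
      qed
      have up: "(1 - t) * x - t * z \<le> L" if "0 \<le> x" "x \<le> L" "0 \<le> z" for x z
      proof -
        have "(1 - t) * x \<le> 1 * L" using t that by (intro mult_mono) auto
        moreover have "t * z \<ge> 0" using t that by simp
        ultimately show ?thesis by simp
      qed
      have "\<bar>max 0 ((1 - t) * a - t * b) ^ r - max 0 ((1 - t) * a' - t * b') ^ r\<bar>
         \<le> real r * L ^ (r - 1) * \<bar>max 0 ((1 - t) * a - t * b) - max 0 ((1 - t) * a' - t * b')\<bar>"
        using up rng L by (intro power_diff_le) auto
      also have "\<dots> \<le> real r * M * \<delta>"
      proof (intro mult_mono)
        have "\<bar>max 0 ((1 - t) * a - t * b) - max 0 ((1 - t) * a' - t * b')\<bar>
          \<le> \<bar>((1 - t) * a - t * b) - ((1 - t) * a' - t * b')\<bar>" by linarith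
        also have "((1 - t) * a - t * b) - ((1 - t) * a' - t * b') = (1 - t) * (a - a') - t * (b - b')"
          by (simp add: algebra_simps)
        also have "\<bar>\<dots>\<bar> \<le> \<bar>a - a'\<bar> + \<bar>b - b'\<bar>" by (rule conv)
        finally show "\<bar>max 0 ((1 - t) * a - t * b) - max 0 ((1 - t) * a' - t * b')\<bar> \<le> \<delta>" using d by linarith
        show "L ^ (r - 1) \<le> M" unfolding M_def using L by (intro power_mono) auto
      qed (use M0 L in \<open>auto simp: \<delta>_def\<close>)
      finally show ?thesis unfolding y .
    qed
    have "\<bar>vol k I \<alpha> \<beta> - vol k I \<alpha>' \<beta>'\<bar> = real k / fact r * \<bar>\<Sum>j\<in>N. dd_weight N j *
       (max 0 (a - real j * ((a + b) / real k)) ^ r - max 0 (a' - real j * ((a' + b') / real k)) ^ r)\<bar>"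
      unfolding vol_def spline_def N_def[symmetric] r_def[symmetric] ab[symmetric]
      by (simp only: right_diff_distrib[symmetric] sum_subtractf[symmetric] abs_mult) simp
    also have "\<dots> \<le> real k / fact r * (\<Sum>j\<in>N. \<bar>dd_weight N j\<bar> * (real r * M * \<delta>))"
      by (intro mult_left_mono order_trans[OF sum_abs] sum_mono)
        (auto simp only: abs_mult zero_le_divide_iff of_nat_0_le_iff fact_ge_zero abs_ge_zero intro!: mult_left_mono tm)
    also have "\<dots> = C * M * \<delta>" by (simp add: C_def sum_distrib_right sum_distrib_left mult_ac)
    finally show "\<bar>vol k I \<alpha> \<beta> - vol k I \<alpha>' \<beta>'\<bar>
        \<le> C * (1 + L) ^ (card I - 1) * (\<bar>\<alpha> - \<alpha>'\<bar> + \<bar>\<beta> - \<beta>'\<bar>)"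
      by (simp add: M_def \<delta>_def r_def)
  qed
qed

section \<open>Reciprocal sums over all tuples\<close>

text \<open>In logarithmic form, splitting off a coordinate or a prime factor of a coordinate is a
  translation of (\<alpha>, \<beta>). Extensionality makes a tuple determined by its entries on
  \<open>I\<close>, so that sums over tuples can be reindexed.\<close>

definition tuples :: "nat \<Rightarrow> nat set \<Rightarrow> real \<Rightarrow> real \<Rightarrow> (nat \<Rightarrow> nat) set" where
  "tuples k I \<alpha> \<beta> = {a \<in> I \<rightarrow>\<^sub>E {1..}. (\<Sum>i\<in>I. real i * ln (real (a i))) \<le> \<alpha> \<and>
     (\<Sum>i\<in>I. (real k - real i) * ln (real (a i))) \<le> \<beta>}"

definition wsum :: "nat \<Rightarrow> nat set \<Rightarrow> (nat \<Rightarrow> nat) set \<Rightarrow> real \<Rightarrow> real \<Rightarrow> real" where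
  "wsum k I X \<alpha> \<beta> = (\<Sum>a\<in>tuples k I \<alpha> \<beta> \<inter> X. 1 / (\<Prod>i\<in>I. real (a i)))"

lemma tuples_ge_1: "a \<in> tuples k I \<alpha> \<beta> \<Longrightarrow> i \<in> I \<Longrightarrow> a i \<ge> 1"
  by (auto simp: tuples_def PiE_iff)

text \<open>Both coefficients \<open>i\<close> and \<open>k - i\<close> are at least 1 and all
  summands are nonnegative. This is where \<open>I\<close> being contained in \<open>{1..<k}\<close>
  makes the set of tuples finite.\<close>

lemma tuples_ln_le:
  assumes "finite I" "I \<subseteq> {1..<k}" "a \<in> tuples k I \<alpha> \<beta>" "i \<in> I"
  shows "ln (real (a i)) \<le> \<alpha>" "ln (real (a i)) \<le> \<beta>"
proof -
  have l0: "ln (real (a j)) \<ge> 0" if "j \<in> I" for j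
    using tuples_ge_1[OF assms(3) that] by simp
  have i: "1 \<le> real i" "1 \<le> real k - real i" using assms by auto
  have "1 * ln (real (a i)) \<le> real i * ln (real (a i))"
    using i l0[OF assms(4)] by (intro mult_right_mono) auto
  also have "\<dots> \<le> (\<Sum>i\<in>I. real i * ln (real (a i)))"
    by (rule member_le_sum) (use assms l0 in auto)
  finally show "ln (real (a i)) \<le> \<alpha>" using assms by (auto simp: tuples_def)
  have "1 * ln (real (a i)) \<le> (real k - real i) * ln (real (a i))"
    using i l0[OF assms(4)] by (intro mult_right_mono) auto
  also have "\<dots> \<le> (\<Sum>i\<in>I. (real k - real i) * ln (real (a i)))"
  proof (rule member_le_sum)
    fix j assume "j \<in> I - {i}"
    then show "0 \<le> (real k - real j) * ln (real (a j))" using assms l0[of j] by (intro mult_nonneg_nonneg) auto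
  qed (use assms in auto)
  finally show "ln (real (a i)) \<le> \<beta>" using assms by (auto simp: tuples_def)
qed

lemma tuples_le:
  assumes "finite I" "I \<subseteq> {1..<k}" "a \<in> tuples k I \<alpha> \<beta>" "i \<in> I" "\<alpha> \<le> L \<or> \<beta> \<le> L"
  shows "a i \<in> {1..nat \<lfloor>exp L\<rfloor>}"
proof -
  have "ln (real (a i)) \<le> L" using tuples_ln_le[OF assms(1-4)] assms(5) by linarith
  then have "real (a i) \<le> exp L"
    using tuples_ge_1[OF assms(3,4)] by (metis exp_ln exp_le_cancel_iff of_nat_0_less_iff less_le_trans zero_less_one)
  then show ?thesis using tuples_ge_1[OF assms(3,4)] by (simp add: le_nat_floor)
qed

lemma tuples_subset_PiE:
  assumes "finite I" "I \<subseteq> {1..<k}" "\<alpha> \<le> L \<or> \<beta> \<le> L"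
  shows "tuples k I \<alpha> \<beta> \<subseteq> I \<rightarrow>\<^sub>E {1..nat \<lfloor>exp L\<rfloor>}"
proof
  fix a assume a: "a \<in> tuples k I \<alpha> \<beta>"
  then show "a \<in> I \<rightarrow>\<^sub>E {1..nat \<lfloor>exp L\<rfloor>}"
    using tuples_le[OF assms(1,2) a _ assms(3)] by (auto simp: PiE_iff tuples_def)
qed

lemma finite_tuples [intro]:
  assumes "finite I" "I \<subseteq> {1..<k}"
  shows "finite (tuples k I \<alpha> \<beta>)"
  by (rule finite_subset[OF tuples_subset_PiE[OF assms, of \<alpha> \<alpha>]]) (auto intro!: finite_PiE assms)

lemma sum_tuples_insert:
  fixes f :: "(nat \<Rightarrow> nat) \<Rightarrow> real"
  assumes "finite I" "i \<notin> I" "insert i I \<subseteq> {1..<k}" "\<alpha> \<le> L \<or> \<beta> \<le> L"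
  shows "(\<Sum>a\<in>tuples k (insert i I) \<alpha> \<beta>. f a) = (\<Sum>n=1..nat \<lfloor>exp L\<rfloor>.
     \<Sum>b\<in>tuples k I (\<alpha> - real i * ln (real n)) (\<beta> - (real k - real i) * ln (real n)). f (b(i := n)))"
    (is "_ = (\<Sum>n=1..?N. \<Sum>b\<in>?T n. f (b(i := n)))")
proof -
  have fin: "finite (?T n)" for n by (rule finite_tuples) (use assms in auto)
  have S: "(\<Sum>j\<in>insert i I. g j * ln (real (a j))) = g i * ln (real (a i)) + (\<Sum>j\<in>I. g j * ln (real (a j)))"
    for g :: "nat \<Rightarrow> real" and a :: "nat \<Rightarrow> nat" using assms by simp
  have upd: "(\<Sum>j\<in>I. g j * ln (real ((a(i := n)) j))) = (\<Sum>j\<in>I. g j * ln (real (a j)))"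
    for g :: "nat \<Rightarrow> real" and a :: "nat \<Rightarrow> nat" and n
    using assms by (intro sum.cong) auto
  have "(\<Sum>n=1..?N. \<Sum>b\<in>?T n. f (b(i := n))) = (\<Sum>(n, b)\<in>Sigma {1..?N} ?T. f (b(i := n)))"
    by (rule sum.Sigma) (use fin in auto)
  also have "\<dots> = (\<Sum>a\<in>tuples k (insert i I) \<alpha> \<beta>. f a)"
  proof (rule sum.reindex_bij_witness[where i = "\<lambda>a. (a i, a(i := undefined))" and j = "\<lambda>(n, b). b(i := n)"], goal_cases)
    case (1 x)
    then show ?case using assms(2) by (auto simp: tuples_def PiE_iff extensional_def)
  next
    case (2 x)
    then obtain n b where x: "x = (n, b)" "n \<in> {1..?N}" "b \<in> ?T n" by auto
    then show ?case unfolding tuples_def mem_Collect_eq S x(1) split_conv upd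
      using assms(2) by (auto simp: tuples_def PiE_iff extensional_def)
  next
    case (3 a)
    then show ?case by auto
  next
    case (4 a)
    have "a i \<in> {1..?N}" by (rule tuples_le) (use 4 assms in auto)
    moreover have "a(i := undefined) \<in> ?T (a i)"
      using 4 unfolding tuples_def mem_Collect_eq S upd using assms(2)
      by (auto simp: PiE_iff extensional_def)
    ultimately show ?case by auto
  next
    case (5 x)
    then show ?case by auto
  qed
  finally show ?thesis by simp
qed

lemma tuples_empty: "tuples k {} \<alpha> \<beta> = (if \<alpha> \<ge> 0 \<and> \<beta> \<ge> 0 then {\<lambda>_. undefined} else {})"
  by (auto simp: tuples_def)

lemma wsum_insert:
  assumes "finite I" "i \<notin> I" "insert i I \<subseteq> {1..<k}" "\<alpha> \<le> L"
  shows "wsum k (insert i I) UNIV \<alpha> \<beta> = (\<Sum>n=1..nat \<lfloor>exp L\<rfloor>.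
     wsum k I UNIV (\<alpha> - real i * ln (real n)) (\<beta> - (real k - real i) * ln (real n)) / real n)"
proof -
  have "(\<Prod>j\<in>insert i I. real ((b(i := n)) j)) = real n * (\<Prod>j\<in>I. real (b j))" for b :: "nat \<Rightarrow> nat" and n
  proof -
    have "(\<Prod>j\<in>I. real ((b(i := n)) j)) = (\<Prod>j\<in>I. real (b j))"
      using assms by (intro prod.cong) auto
    then show ?thesis using assms by simp
  qed
  then show ?thesis unfolding wsum_def Int_UNIV_right
    using assms by (subst sum_tuples_insert[of I i k \<alpha> L])
      (simp_all add: sum_divide_distrib mult.commute del: fun_upd_apply)
qed

section \<open>Logarithmic sums compared with integrals\<close>

lemma le_floor_exp_iff:
  assumes "n \<ge> 1"
  shows "n \<le> nat \<lfloor>exp x\<rfloor> \<longleftrightarrow> ln (real n) \<le> x"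
proof -
  have "n \<le> nat \<lfloor>exp x\<rfloor> \<longleftrightarrow> real n \<le> exp x"
    using assms by (simp add: le_nat_iff le_floor_iff)
  also have "\<dots> \<longleftrightarrow> exp (ln (real n)) \<le> exp x" using assms by simp
  finally show ?thesis by simp
qed

lemma sum_inverse_le:
  assumes "L \<ge> 0"
  shows "(\<Sum>n=1..nat \<lfloor>exp L\<rfloor>. 1 / real n) \<le> 1 + L"
proof -
  define N where "N = nat \<lfloor>exp L\<rfloor>"
  have N: "N \<ge> 1" using assms by (simp add: N_def le_nat_iff)
  have "(\<Sum>n=1..N. 1 / real n) = harm N" by (simp add: harm_def inverse_eq_divide)
  also have "harm N \<le> 1 + ln (real N)"
    using euler_mascheroni_sequence_decreasing[of 1 N] N by (simp add: harm_def)
  also have "ln (real N) \<le> L"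
    using le_floor_exp_iff[OF N, of L] unfolding N_def by blast
  finally show ?thesis by (simp add: N_def)
qed

lemma sum_inverse_squares_le: "(\<Sum>n=1..N. 1 / real n ^ 2) \<le> 2"
proof -
  have "(\<Sum>n=1..Suc N. 1 / real n ^ 2) \<le> 2 - 1 / real (Suc N)" for N
  proof (induction N)
    case (Suc N)
    define x where "x = real (Suc N)"
    have x: "x > 0" by (simp add: x_def)
    have "1 / (x + 1) ^ 2 \<le> 1 / (x * (x + 1))"
      using x by (intro divide_left_mono) (auto simp: power2_eq_square)
    also have "\<dots> = 1 / x - 1 / (x + 1)" using x by (simp add: field_simps)
    finally have "1 / real (Suc (Suc N)) ^ 2 \<le> 1 / real (Suc N) - 1 / real (Suc (Suc N))"
      by (simp add: x_def add_ac)
    moreover have "(\<Sum>n=1..Suc (Suc N). 1 / real n ^ 2) = (\<Sum>n=1..Suc N. 1 / real n ^ 2) + 1 / real (Suc (Suc N)) ^ 2"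
      by simp
    ultimately show ?case using Suc by linarith
  qed simp
  from this[of N] have "(\<Sum>n=1..N. 1 / real n ^ 2) + 1 / real (Suc N) ^ 2 \<le> 2 - 1 / real (Suc N)" by simp
  moreover have "0 \<le> 1 / real (Suc N) ^ 2" "0 \<le> 1 / real (Suc N)" by simp_all
  ultimately show ?thesis by linarith
qed

text \<open>The summand for \<open>n\<close> is compared with the integral over
  \<open>[ln n, ln (n + 1)]\<close>. The length of this interval differs from \<open>1/n\<close> by
  at most \<open>1/n^2\<close>, and the integrand varies on it by at most
  \<Lambda>\<open>/n\<close>; so each \<open>n\<close> costs at most
  \<open>(M + \<Lambda>) / n^2\<close>. The factor 2 bounds the sum of the inverse squares.\<close>

lemma sum_log_integral:
  fixes \<phi> :: "real \<Rightarrow> real"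
  assumes I: "(\<phi> has_integral v) {0..ln (real N + 1)}"
    and M: "\<And>u. u \<ge> 0 \<Longrightarrow> \<bar>\<phi> u\<bar> \<le> M"
    and lip: "\<And>u w. u \<ge> 0 \<Longrightarrow> w \<ge> 0 \<Longrightarrow> \<bar>\<phi> u - \<phi> w\<bar> \<le> \<Lambda> * \<bar>u - w\<bar>"
  shows "\<bar>(\<Sum>n=1..N. \<phi> (ln (real n)) / real n) - v\<bar> \<le> 2 * (M + \<Lambda>)"
proof -
  have \<Lambda>0: "\<Lambda> \<ge> 0" using lip[of 0 1] by simp
  have M0: "M \<ge> 0" using M[of 0] by simp
  have "\<bar>(\<Sum>n=1..N. \<phi> (ln (real n)) / real n) - v\<bar> \<le> (\<Sum>n=1..N. (M + \<Lambda>) * (1 / real n ^ 2))"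
    using I
  proof (induction N arbitrary: v)
    case 0
    then show ?case using has_integral_unique[of \<phi> v "{0}" 0] by (simp add: has_integral_refl)
  next
    case (Suc N)
    define a b where "a = ln (real N + 1)" and "b = ln (real N + 2)"
    have ab: "0 \<le> a" "a \<le> b" by (auto simp: a_def b_def)
    have Sv: "(\<phi> has_integral v) {0..b}" using Suc.prems by (simp add: b_def add_ac)
    then have int: "\<phi> integrable_on {0..b}" by auto
    have i1: "(\<phi> has_integral integral {0..a} \<phi>) {0..a}"
      using integrable_on_subinterval[OF int, of 0 a] ab by (auto simp: integrable_integral)
    have i2: "(\<phi> has_integral integral {a..b} \<phi>) {a..b}"
      using integrable_on_subinterval[OF int, of a b] ab by (auto simp: integrable_integral)
    have v: "v = integral {0..a} \<phi> + integral {a..b} \<phi>"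
      using has_integral_combine[OF ab i1 i2] Sv has_integral_unique by blast
    have lnq: "b - a = ln (1 + 1 / (real N + 1))"
    proof -
      have "b - a = ln ((real N + 2) / (real N + 1))" unfolding a_def b_def by (subst ln_div) auto
      also have "(real N + 2) / (real N + 1) = 1 + 1 / (real N + 1)" by (simp add: field_simps)
      finally show ?thesis .
    qed
    have d1: "b - a \<le> 1 / (real N + 1)"
      using lnq ln_add_one_self_le_self[of "1 / (real N + 1)"] by simp
    have d2: "1 / (real N + 1) - (b - a) \<le> 1 / (real N + 1) ^ 2"
      using lnq ln_one_plus_pos_lower_bound[of "1 / (real N + 1)"] by (simp add: power_divide)
    have c: "((\<lambda>u. \<phi> u - \<phi> a) has_integral integral {a..b} \<phi> - (b - a) * \<phi> a) {a..b}"
      using has_integral_diff[OF i2 has_integral_const_real[of "\<phi> a" a b]] ab by simp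
    have "norm (integral {a..b} \<phi> - (b - a) * \<phi> a) \<le> \<Lambda> * (b - a) * measure lborel {a..b}"
    proof (rule has_integral_bound_real[OF _ _ c])
      fix u assume "u \<in> {a..b} - {}"
      then have "\<bar>\<phi> u - \<phi> a\<bar> \<le> \<Lambda> * \<bar>u - a\<bar>" "\<bar>u - a\<bar> \<le> b - a" using ab lip[of u a] by auto
      then show "norm (\<phi> u - \<phi> a) \<le> \<Lambda> * (b - a)"
        using \<Lambda>0 by (smt (verit) mult_left_mono real_norm_def)
    qed (use \<Lambda>0 ab in auto)
    also have "\<dots> = \<Lambda> * (b - a) ^ 2" using ab by (simp add: power2_eq_square)
    also have "\<dots> \<le> \<Lambda> * (1 / (real N + 1)) ^ 2"
      using d1 ab \<Lambda>0 by (intro mult_left_mono power_mono) auto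
    finally have e1: "\<bar>integral {a..b} \<phi> - (b - a) * \<phi> a\<bar> \<le> \<Lambda> * (1 / (real N + 1) ^ 2)"
      by (simp add: power_divide)
    have "\<bar>\<phi> a * (1 / (real N + 1) - (b - a))\<bar> \<le> M * (1 / (real N + 1) ^ 2)"
      unfolding abs_mult using M[of a] ab d1 d2 M0 by (intro mult_mono) auto
    moreover have "\<phi> a / (real N + 1) - integral {a..b} \<phi>
      = \<phi> a * (1 / (real N + 1) - (b - a)) - (integral {a..b} \<phi> - (b - a) * \<phi> a)"
      by (simp add: algebra_simps)
    ultimately have "\<bar>\<phi> a / (real N + 1) - integral {a..b} \<phi>\<bar> \<le> (M + \<Lambda>) * (1 / (real N + 1) ^ 2)"
      using e1 unfolding distrib_right by linarith
    moreover have "\<bar>(\<Sum>n=1..N. \<phi> (ln (real n)) / real n) - integral {0..a} \<phi>\<bar> \<le> (\<Sum>n=1..N. (M + \<Lambda>) * (1 / real n ^ 2))"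
      by (rule Suc.IH) (use i1 in \<open>simp add: a_def\<close>)
    ultimately show ?case unfolding v by (simp add: a_def add_ac)
  qed
  also have "\<dots> \<le> (M + \<Lambda>) * 2"
    unfolding sum_distrib_left[symmetric] using M0 \<Lambda>0 by (intro mult_left_mono sum_inverse_squares_le) auto
  finally show ?thesis by simp
qed

lemma le_ln_floor_exp:
  assumes "L \<ge> 0"
  shows "L \<le> ln (real (nat \<lfloor>exp L\<rfloor>) + 1)"
proof -
  have "exp L \<le> real (nat \<lfloor>exp L\<rfloor>) + 1" by linarith
  moreover have "0 < real (nat \<lfloor>exp L\<rfloor>) + 1" by linarith
  ultimately show ?thesis using ln_ge_iff by blast
qed

text \<open>With \<open>m\<close> the smaller of the two quotients, the sum is a harmonic sum up to
  \<open>exp m\<close>, hence between \<open>m\<close> and \<open>1 + m\<close>, and the volume is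
  \<open>m\<close>. For negative \<open>m\<close> both are 0.\<close>

lemma wsum_singleton:
  assumes "1 \<le> i" "i < k"
  shows "\<bar>wsum k {i} UNIV \<alpha> \<beta> - vol k {i} \<alpha> \<beta>\<bar> \<le> 1"
proof -
  define m where "m = min (\<alpha> / real i) (\<beta> / (real k - real i))"
  have ik: "0 < real i" "0 < real k - real i" using assms by auto
  have iff: "\<alpha> - real i * l \<ge> 0 \<and> \<beta> - (real k - real i) * l \<ge> 0 \<longleftrightarrow> l \<le> m" for l
    using ik by (auto simp: m_def field_simps)
  have v: "vol k {i} \<alpha> \<beta> = max 0 m"
  proof -
    have "vol k {i} \<alpha> \<beta> = max 0 (min (max 0 \<alpha> / real i) (max 0 \<beta> / (real k - real i)))"
      unfolding vol_def using assms by (subst spline_singleton) auto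
    also have "max 0 \<alpha> / real i = max 0 (\<alpha> / real i)" using ik by (simp add: max_def field_simps)
    also have "max 0 \<beta> / (real k - real i) = max 0 (\<beta> / (real k - real i))"
      using ik by (simp add: max_def field_simps)
    finally show ?thesis by (simp add: m_def)
  qed
  have W: "wsum k {i} UNIV \<alpha> \<beta> = (\<Sum>n | n \<in> {1..nat \<lfloor>exp \<alpha>\<rfloor>} \<and> ln (real n) \<le> m. 1 / real n)"
  proof -
    have "wsum k {i} UNIV \<alpha> \<beta> = (\<Sum>n=1..nat \<lfloor>exp \<alpha>\<rfloor>.
       wsum k {} UNIV (\<alpha> - real i * ln (real n)) (\<beta> - (real k - real i) * ln (real n)) / real n)"
      using assms by (intro wsum_insert) auto
    also have "\<dots> = (\<Sum>n=1..nat \<lfloor>exp \<alpha>\<rfloor>. if ln (real n) \<le> m then 1 / real n else 0)"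
      unfolding wsum_def tuples_empty iff by (intro sum.cong) auto
    also have "\<dots> = (\<Sum>n | n \<in> {1..nat \<lfloor>exp \<alpha>\<rfloor>} \<and> ln (real n) \<le> m. 1 / real n)"
      by (rule sum.inter_filter[symmetric]) simp
    finally show ?thesis .
  qed
  show ?thesis
  proof (cases "m \<ge> 0")
    case False
    have "0 \<le> ln (real n)" if "n \<in> {1..nat \<lfloor>exp \<alpha>\<rfloor>}" for n :: nat using that by simp
    then have "{n. n \<in> {1..nat \<lfloor>exp \<alpha>\<rfloor>} \<and> ln (real n) \<le> m} = {}"
      using False by (blast intro: order_trans)
    then have "wsum k {i} UNIV \<alpha> \<beta> = 0" unfolding W by (simp only: sum.empty)
    then show ?thesis using False v by simp
  next
    case True
    have "{n. n \<in> {1..nat \<lfloor>exp \<alpha>\<rfloor>} \<and> ln (real n) \<le> m} = {1..nat \<lfloor>exp m\<rfloor>}"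
    proof -
      have "n \<in> {1..nat \<lfloor>exp \<alpha>\<rfloor>} \<and> ln (real n) \<le> m \<longleftrightarrow> n \<in> {1..nat \<lfloor>exp m\<rfloor>}" for n :: nat
      proof (cases "n \<ge> 1")
        case n: True
        note e = le_floor_exp_iff[OF n]
        have "ln (real n) \<le> \<alpha>" if "ln (real n) \<le> m"
        proof -
          have "ln (real n) \<le> real i * ln (real n)" using assms n mult_right_mono[of 1 "real i" "ln (real n)"] by simp
          also have "\<dots> \<le> \<alpha>" using iff that by auto
          finally show ?thesis .
        qed
        then show ?thesis using n e by auto
      qed auto
      then show ?thesis by blast
    qed
    then have "wsum k {i} UNIV \<alpha> \<beta> = (\<Sum>n=1..nat \<lfloor>exp m\<rfloor>. 1 / real n)" using W by simp
    moreover have "\<dots> \<le> 1 + m" by (rule sum_inverse_le[OF True])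
    moreover have "m \<le> (\<Sum>n=1..nat \<lfloor>exp m\<rfloor>. 1 / real n)"
      using le_ln_floor_exp[OF True] ln_le_harm[of "nat \<lfloor>exp m\<rfloor>"]
      by (simp add: harm_def inverse_eq_divide)
    ultimately show ?thesis using v True by simp
  qed
qed

text \<open>Each new coordinate raises the exponent of the error by one. Replacing the inner sums by
  volumes multiplies the old error by a harmonic sum, at most \<open>1 + L\<close>; replacing the
  outer sum by an integral costs the supremum and the Lipschitz constant of the lower-dimensional
  volume.\<close>

lemma wsum_vol:
  assumes "finite I" "I \<noteq> {}" "I \<subseteq> {1..<k}"
  shows "\<exists>C\<ge>0. \<forall>L\<ge>0. \<forall>\<alpha>\<le>L. \<forall>\<beta>\<le>L. \<bar>wsum k I UNIV \<alpha> \<beta> - vol k I \<alpha> \<beta>\<bar> \<le> C * (1 + L) ^ (card I - 1)"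
  using assms
proof (induction I rule: finite_ne_induct)
  case (singleton i)
  then show ?case using wsum_singleton[of i k] by (intro exI[of _ 1]) auto
next
  case (insert i I)
  have sub: "I \<subseteq> {1..<k}" using insert.prems by auto
  have ik: "0 < real i" "0 < real k - real i" "k \<ge> 2" using insert.prems by auto
  obtain C where C0: "C \<ge> 0" and C': "\<forall>L\<ge>0. \<forall>\<alpha>\<le>L. \<forall>\<beta>\<le>L.
    \<bar>wsum k I UNIV \<alpha> \<beta> - vol k I \<alpha> \<beta>\<bar> \<le> C * (1 + L) ^ (card I - 1)"
    using insert.IH[OF sub] by (elim exE conjE)
  obtain D where D0: "D \<ge> 0" and D': "\<forall>L\<ge>0. \<forall>\<alpha>\<le>L. \<forall>\<beta>\<le>L. \<forall>\<alpha>'\<le>L. \<forall>\<beta>'\<le>L.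
    \<bar>vol k I \<alpha> \<beta> - vol k I \<alpha>' \<beta>'\<bar> \<le> D * (1 + L) ^ (card I - 1) * (\<bar>\<alpha> - \<alpha>'\<bar> + \<bar>\<beta> - \<beta>'\<bar>)"
    using vol_Lipschitz[OF insert.hyps(1,2) sub] by (elim exE conjE)
  note C = C0 C'[rule_format] and D = D0 D'[rule_format]
  have card: "card I > 0" using insert.hyps by (simp add: card_gt_0_iff)
  show ?case
  proof (intro exI[of _ "C + 2 * (2 * D + D * real k)"] conjI allI impI)
    show "C + 2 * (2 * D + D * real k) \<ge> 0" using C0 D0 by simp
    fix L \<alpha> \<beta> :: real assume L: "L \<ge> 0" "\<alpha> \<le> L" "\<beta> \<le> L"
    define N where "N = nat \<lfloor>exp L\<rfloor>"
    define P where "P = (1 + L) ^ (card I - 1)"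
    have P: "P \<ge> 0" "P * (1 + L) = (1 + L) ^ card I" using L card power_Suc2[of "1 + L" "card I - 1"] by (auto simp: P_def simp del: power_Suc)
    define x where "x = (\<lambda>u. \<alpha> - real i * u)"
    define y where "y = (\<lambda>u. \<beta> - (real k - real i) * u)"
    have xy: "x u \<le> L" "y u \<le> L" if "u \<ge> 0" for u
    proof -
      have "real i * u \<ge> 0" "(real k - real i) * u \<ge> 0" using that ik by auto
      then show "x u \<le> L" "y u \<le> L" using L by (auto simp: x_def y_def)
    qed
    have "\<bar>wsum k (insert i I) UNIV \<alpha> \<beta> - (\<Sum>n=1..N. vol k I (x (ln (real n))) (y (ln (real n))) / real n)\<bar>
      = \<bar>\<Sum>n=1..N. (wsum k I UNIV (x (ln (real n))) (y (ln (real n))) - vol k I (x (ln (real n))) (y (ln (real n)))) / real n\<bar>"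
      using insert.hyps insert.prems L by (subst wsum_insert[of I i k \<alpha> L])
        (auto simp: x_def y_def N_def diff_divide_distrib sum_subtractf)
    also have "\<dots> \<le> (\<Sum>n=1..N. C * P * (1 / real n))"
    proof (intro order_trans[OF sum_abs] sum_mono)
      fix n assume n: "n \<in> {1..N}"
      have "\<bar>wsum k I UNIV (x (ln (real n))) (y (ln (real n))) - vol k I (x (ln (real n))) (y (ln (real n)))\<bar> \<le> C * P"
        unfolding P_def using n by (intro C xy L) auto
      then show "\<bar>(wsum k I UNIV (x (ln (real n))) (y (ln (real n))) - vol k I (x (ln (real n))) (y (ln (real n)))) / real n\<bar>
         \<le> C * P * (1 / real n)" using n by (simp add: divide_right_mono)
    qed
    also have "\<dots> \<le> C * P * (1 + L)"
      unfolding sum_distrib_left[symmetric] N_def using C0 P L by (intro mult_left_mono sum_inverse_le) auto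
    finally have e1: "\<bar>wsum k (insert i I) UNIV \<alpha> \<beta> - (\<Sum>n=1..N. vol k I (x (ln (real n))) (y (ln (real n))) / real n)\<bar>
       \<le> C * (1 + L) ^ card I" using P by (simp add: mult.assoc)
    \<comment> \<open>The supremum \<open>D * P * (2 * L)\<close> comes from the Lipschitz bound
      against the value 0 at the origin; the slope \<open>D * P * k\<close> arises because the two
      arguments move with speeds \<open>i\<close> and \<open>k - i\<close>.\<close>
    have e2: "\<bar>(\<Sum>n=1..N. vol k I (x (ln (real n))) (y (ln (real n))) / real n) - vol k (insert i I) \<alpha> \<beta>\<bar>
      \<le> 2 * (D * P * (2 * L) + D * P * real k)"
    proof (rule sum_log_integral[where \<phi> = "\<lambda>u. vol k I (x u) (y u)"])
      \<comment> \<open>Since \<open>k \<ge> 2\<close>, the endpoint is at most \<open>L\<close>, so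
        the range of integration covers the whole support.\<close>
      have "(\<alpha> + \<beta>) / real k \<le> (2 * L) / 2" using L ik by (intro frac_le) auto
      also have "\<dots> \<le> ln (real N + 1)" using le_ln_floor_exp[OF L(1)] by (simp add: N_def)
      finally show "((\<lambda>u. vol k I (x u) (y u)) has_integral vol k (insert i I) \<alpha> \<beta>) {0..ln (real N + 1)}"
        unfolding x_def y_def using insert.hyps insert.prems by (intro vol_insert) auto
    next
      fix u :: real assume u: "u \<ge> 0"
      show "\<bar>vol k I (x u) (y u)\<bar> \<le> D * P * (2 * L)"
      proof (cases "x u \<le> 0 \<or> y u \<le> 0")
        case True
        then show ?thesis using vol_eq_0[OF insert.hyps(1,2) sub True] D0 P L by simp
      next
        case False
        have "\<bar>vol k I (x u) (y u) - vol k I 0 0\<bar> \<le> D * P * (\<bar>x u - 0\<bar> + \<bar>y u - 0\<bar>)"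
          unfolding P_def using xy[OF u] L by (intro D) auto
        also have "\<dots> \<le> D * P * (2 * L)" using False xy[OF u] D0 P by (intro mult_left_mono) auto
        finally show ?thesis using vol_eq_0[OF insert.hyps(1,2) sub, of 0 0] by simp
      qed
    next
      fix u w :: real assume u: "u \<ge> 0" "w \<ge> 0"
      have "\<bar>vol k I (x u) (y u) - vol k I (x w) (y w)\<bar> \<le> D * P * (\<bar>x u - x w\<bar> + \<bar>y u - y w\<bar>)"
        unfolding P_def using xy u L by (intro D) auto
      also have "\<bar>x u - x w\<bar> + \<bar>y u - y w\<bar> = real k * \<bar>u - w\<bar>"
      proof -
        have "x u - x w = real i * (w - u)" "y u - y w = (real k - real i) * (w - u)"
          by (auto simp: x_def y_def algebra_simps)
        then have "\<bar>x u - x w\<bar> + \<bar>y u - y w\<bar> = real i * \<bar>w - u\<bar> + (real k - real i) * \<bar>w - u\<bar>"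
          using ik by (simp only: abs_mult abs_of_pos)
        then show ?thesis by (simp add: algebra_simps abs_minus_commute)
      qed
      finally show "\<bar>vol k I (x u) (y u) - vol k I (x w) (y w)\<bar> \<le> D * P * real k * \<bar>u - w\<bar>" by (simp add: mult_ac)
    qed
    have "D * P * (2 * L) + D * P * real k \<le> D * P * (2 * (1 + L)) + D * P * real k * (1 + L)"
    proof (intro add_mono mult_left_mono)
      show "D * P * real k \<le> D * P * real k * (1 + L)"
        using mult_left_mono[of 1 "1 + L" "D * P * real k"] D0 P L by simp
    qed (use D0 P L in auto)
    also have "\<dots> = (2 * D + D * real k) * (P * (1 + L))" by (simp add: algebra_simps)
    finally have "2 * (D * P * (2 * L) + D * P * real k) \<le> 2 * ((2 * D + D * real k) * (1 + L) ^ card I)"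
      unfolding P(2) by (rule mult_left_mono) simp
    with e1 e2 have "\<bar>wsum k (insert i I) UNIV \<alpha> \<beta> - vol k (insert i I) \<alpha> \<beta>\<bar>
        \<le> C * (1 + L) ^ card I + 2 * ((2 * D + D * real k) * (1 + L) ^ card I)" by linarith
    then show "\<bar>wsum k (insert i I) UNIV \<alpha> \<beta> - vol k (insert i I) \<alpha> \<beta>\<bar>
        \<le> (C + 2 * (2 * D + D * real k)) * (1 + L) ^ (card (insert i I) - 1)"
      using insert.hyps insert.prems by (simp add: algebra_simps)
  qed
qed

section \<open>Sieving by one prime\<close>

text \<open>Multiplication of the entry \<open>i\<close> by \<open>p\<close> is a bijection from
  \<open>X\<close> onto \<open>Y\<close> within the tuples; it translates the region and divides
  each summand by \<open>p\<close>.\<close>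

lemma wsum_scale:
  assumes "finite I" "I \<subseteq> {1..<k}" "i \<in> I" "p \<ge> 1"
    and X: "\<And>a. a \<in> I \<rightarrow>\<^sub>E {1..} \<Longrightarrow> a(i := p * a i) \<in> Y \<longleftrightarrow> a \<in> X"
    and Y: "\<And>a. a \<in> Y \<Longrightarrow> p dvd a i"
  shows "wsum k I Y \<alpha> \<beta> = wsum k I X (\<alpha> - real i * ln (real p)) (\<beta> - (real k - real i) * ln (real p)) / real p"
proof -
  define T where "T = tuples k I (\<alpha> - real i * ln (real p)) (\<beta> - (real k - real i) * ln (real p))"
  define u where "u = (\<lambda>a::nat \<Rightarrow> nat. a(i := p * a i))"
  have S: "(\<Sum>j\<in>I. g j * ln (real (u a j))) = g i * ln (real p) + (\<Sum>j\<in>I. g j * ln (real (a j)))"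
    if a: "a \<in> I \<rightarrow>\<^sub>E {1..}" for g :: "nat \<Rightarrow> real" and a :: "nat \<Rightarrow> nat"
  proof -
    have "a i \<ge> 1" using a assms by (auto simp: PiE_iff)
    then have "ln (real (u a i)) = ln (real p) + ln (real (a i))"
      using assms by (simp add: u_def ln_mult)
    moreover have "(\<Sum>j\<in>I - {i}. g j * ln (real (u a j))) = (\<Sum>j\<in>I - {i}. g j * ln (real (a j)))"
      by (rule sum.cong) (auto simp: u_def)
    ultimately show ?thesis using assms by (simp add: sum.remove[of I i] algebra_simps)
  qed
  have P: "(\<Prod>j\<in>I. real (u a j)) = real p * (\<Prod>j\<in>I. real (a j))" for a
  proof -
    have "(\<Prod>j\<in>I - {i}. real (u a j)) = (\<Prod>j\<in>I - {i}. real (a j))"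
      by (rule prod.cong) (auto simp: u_def)
    then show ?thesis using assms by (simp add: prod.remove[of I i]) (simp add: u_def)
  qed
  have u_PiE: "u a \<in> I \<rightarrow>\<^sub>E {1..} \<longleftrightarrow> a \<in> I \<rightarrow>\<^sub>E {1..}" for a
    using assms(3,4) by (auto simp: u_def PiE_iff extensional_def Suc_le_eq)
  have mem: "u a \<in> tuples k I \<alpha> \<beta> \<inter> Y \<longleftrightarrow> a \<in> T \<inter> X" for a
  proof (cases "a \<in> I \<rightarrow>\<^sub>E {1..}")
    case True
    have uY: "u a \<in> Y \<longleftrightarrow> a \<in> X" using X[OF True] by (simp add: u_def)
    show ?thesis unfolding T_def tuples_def Int_iff mem_Collect_eq S[OF True] uY u_PiE
      by (simp only: True simp_thms) auto
  next
    case False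
    then show ?thesis unfolding T_def tuples_def Int_iff mem_Collect_eq u_PiE by simp
  qed
  have uinv: "u (b(i := b i div p)) = b" if "b \<in> Y" for b
    using Y[OF that] by (auto simp: u_def)
  have uinv': "(u a)(i := u a i div p) = a" for a
    using assms by (auto simp: u_def)
  have "wsum k I Y \<alpha> \<beta> = (\<Sum>a\<in>T \<inter> X. 1 / (\<Prod>j\<in>I. real (u a j)))"
    unfolding wsum_def
  proof (rule sum.reindex_bij_witness[where i = u and j = "\<lambda>b. b(i := b i div p)"], goal_cases)
    case (1 b)
    then show ?case using uinv by auto
  next
    case (2 b)
    then show ?case using uinv[of b] mem[of "b(i := b i div p)"] by auto
  next
    case (3 a)
    show ?case by (rule uinv')
  next
    case (4 a)
    then show ?case using mem by blast
  next
    case (5 b)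
    then show ?case using uinv by auto
  qed
  then show ?thesis unfolding P by (simp add: wsum_def T_def sum_divide_distrib mult.commute)
qed

lemma wsum_diff:
  assumes "finite I" "I \<subseteq> {1..<k}" "Y \<subseteq> X"
  shows "wsum k I (X - Y) \<alpha> \<beta> = wsum k I X \<alpha> \<beta> - wsum k I Y \<alpha> \<beta>"
proof -
  have "tuples k I \<alpha> \<beta> \<inter> (X - Y) = (tuples k I \<alpha> \<beta> \<inter> X) - (tuples k I \<alpha> \<beta> \<inter> Y)" by auto
  then show ?thesis unfolding wsum_def
    using assms finite_tuples[OF assms(1,2)] by (simp only:) (rule sum_diff, auto)
qed

text \<open>Used for \<open>n = p\<close> and \<open>n = p ^ 2\<close> only. The set
  \<open>J\<close> of inspected coordinates is a parameter so that the condition can be imposed one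
  coordinate at a time.\<close>

definition pfree :: "nat \<Rightarrow> nat set \<Rightarrow> (nat \<Rightarrow> nat) set" where
  "pfree n J = {a. \<not> n dvd (\<Prod>j\<in>J. a j)}"

lemma pfree_subset: "p dvd n \<Longrightarrow> pfree p J \<subseteq> pfree n J"
  by (auto simp: pfree_def intro: dvd_trans)

lemma square_dvd_mult_iff:
  fixes p m n :: nat
  assumes "prime p" "\<not> p ^ 2 dvd m"
  shows "p ^ 2 dvd n * m \<longleftrightarrow> (if p dvd m then p dvd n else p ^ 2 dvd n)"
proof (cases "p dvd m")
  case True
  then obtain c where c: "m = p * c" by auto
  have "\<not> p dvd c" using assms by (auto simp: c power2_eq_square)
  then show ?thesis using assms by (auto simp: c power2_eq_square prime_dvd_mult_iff mult.left_commute)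
next
  case False
  then have "coprime (p ^ 2) m" using assms by (simp add: prime_imp_coprime)
  then show ?thesis using False by (simp add: coprime_dvd_mult_left_iff)
qed

text \<open>Here \<Omega> collects the conditions at the primes already treated, which
  multiplication by \<open>p\<close> does not affect, and \<open>s\<close> counts how often a factor
  \<open>p\<close> has been divided out of the entry \<open>i\<close>. A square \<open>p ^ 2\<close>
  can newly arise in two exclusive ways: the product over \<open>J\<close> already contains one
  \<open>p\<close> and the entry contributes another, or that product is free of \<open>p\<close>
  and the entry alone contains \<open>p ^ 2\<close>.\<close>

lemma wsum_pfree_insert:
  assumes I: "finite I" "I \<subseteq> {1..<k}" and J: "J \<subseteq> I" "i \<in> I" "i \<notin> J" and p: "prime p"
    and \<Omega>: "\<And>(a :: nat \<Rightarrow> nat) i. a \<in> I \<rightarrow>\<^sub>E {1..} \<Longrightarrow> i \<in> I \<Longrightarrow> a(i := p * a i) \<in> \<Omega> \<longleftrightarrow> a \<in> \<Omega>"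
    and W: "\<And>X s. W X s = wsum k I (\<Omega> \<inter> X) (\<alpha> - s * (real i * ln (real p))) (\<beta> - s * ((real k - real i) * ln (real p)))"
  shows "W (pfree p (insert i J)) 0 = W (pfree p J) 0 - W (pfree p J) 1 / real p" (is ?D)
    and "W (pfree (p ^ 2) (insert i J)) 0 = W (pfree (p ^ 2) J) 0
      - (W (pfree (p ^ 2) J) 1 - W (pfree p J) 1) / real p - W (pfree p J) 2 / real p ^ 2" (is ?Q)
proof -
  have fJ: "finite J" using I J finite_subset by blast
  have p1: "p \<ge> 1" using p prime_ge_1_nat by blast
  have prod_ins: "(\<Prod>j\<in>insert i J. a j) = a i * (\<Prod>j\<in>J. a j)" for a :: "nat \<Rightarrow> nat"
    using fJ J by simp
  have upd: "(\<Prod>j\<in>J. (a(i := x)) j) = (\<Prod>j\<in>J. a j)" for a :: "nat \<Rightarrow> nat" and x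
    using J by (intro prod.cong) auto
  have pd: "p dvd p ^ 2" by simp
  define A where "A = pfree p J"
  define B where "B = pfree (p ^ 2) J"
  have AB: "A \<subseteq> B" unfolding A_def B_def by (rule pfree_subset[OF pd])
  have A_upd: "a(i := x) \<in> A \<longleftrightarrow> a \<in> A" and B_upd: "a(i := x) \<in> B \<longleftrightarrow> a \<in> B" for a x
    by (simp_all only: A_def B_def pfree_def mem_Collect_eq upd)
  have scale: "W {a \<in> X. p dvd a i} s = W X (s + 1) / real p"
    if "\<And>a x. a(i := x) \<in> X \<longleftrightarrow> a \<in> X" for X s
  proof -
    have "W {a \<in> X. p dvd a i} s = wsum k I (\<Omega> \<inter> X)
       (\<alpha> - s * (real i * ln (real p)) - real i * ln (real p))
       (\<beta> - s * ((real k - real i) * ln (real p)) - (real k - real i) * ln (real p)) / real p"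
      unfolding W by (rule wsum_scale[OF I J(2) p1]) (use \<Omega>[OF _ J(2)] that in auto)
    then show ?thesis unfolding W by (simp add: algebra_simps)
  qed
  \<comment> \<open>Two divisions by \<open>p\<close>: the first turns the condition
    \<open>p ^ 2 dvd a i\<close> into \<open>p dvd a i\<close>, the second removes it.\<close>
  have scale2: "W {a \<in> A. p ^ 2 dvd a i} 0 = W A 2 / real p ^ 2"
  proof -
    have "W {a \<in> A. p ^ 2 dvd a i} 0 = wsum k I (\<Omega> \<inter> {a \<in> A. p dvd a i})
       (\<alpha> - 0 * (real i * ln (real p)) - real i * ln (real p))
       (\<beta> - 0 * ((real k - real i) * ln (real p)) - (real k - real i) * ln (real p)) / real p"
      unfolding W
    proof (rule wsum_scale[OF I J(2) p1])
      fix a :: "nat \<Rightarrow> nat" assume a: "a \<in> I \<rightarrow>\<^sub>E {1..}"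
      show "a(i := p * a i) \<in> \<Omega> \<inter> {a \<in> A. p\<^sup>2 dvd a i} \<longleftrightarrow> a \<in> \<Omega> \<inter> {a \<in> A. p dvd a i}"
        using \<Omega>[OF a J(2)] A_upd[of a "p * a i"] p1 by (simp add: power2_eq_square)
    qed (auto intro: dvd_trans[OF pd])
    also have "\<dots> = W {a \<in> A. p dvd a i} 1 / real p" unfolding W by simp
    also have "W {a \<in> A. p dvd a i} 1 = W A 2 / real p" using scale[of A 1] A_upd by simp
    finally show ?thesis by (simp add: power2_eq_square)
  qed
  have diff: "W (X - Y) s = W X s - W Y s" if "Y \<subseteq> X" for X Y s
    unfolding W Diff_Int_distrib using that by (intro wsum_diff I) auto
  have "pfree p (insert i J) = A - {a \<in> A. p dvd a i}"
    unfolding A_def pfree_def prod_ins using p by (auto simp: prime_dvd_mult_iff)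
  then show ?D using diff[of "{a \<in> A. p dvd a i}" A 0] scale[of A 0] A_upd by (simp add: A_def)
  have "pfree (p ^ 2) (insert i J) = B - {a \<in> B - A. p dvd a i} - {a \<in> A. p ^ 2 dvd a i}"
  proof (rule set_eqI)
    fix a :: "nat \<Rightarrow> nat"
    show "a \<in> pfree (p ^ 2) (insert i J) \<longleftrightarrow> a \<in> B - {a \<in> B - A. p dvd a i} - {a \<in> A. p ^ 2 dvd a i}"
    proof (cases "a \<in> B")
      case True
      then have "\<not> p ^ 2 dvd (\<Prod>j\<in>J. a j)" by (simp add: B_def pfree_def)
      then show ?thesis using True
        by (simp add: A_def pfree_def prod_ins square_dvd_mult_iff[OF p])
    next
      case False
      then show ?thesis by (simp add: B_def pfree_def prod_ins)
    qed
  qed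
  also have "W \<dots> 0 = W B 0 - W {a \<in> B - A. p dvd a i} 0 - W {a \<in> A. p ^ 2 dvd a i} 0"
    using AB by (subst diff, force, subst diff, force) simp
  also have "W {a \<in> B - A. p dvd a i} 0 = W (B - A) 1 / real p"
    using scale[of "B - A" 0] A_upd B_upd by simp
  also have "W (B - A) 1 = W B 1 - W A 1" by (rule diff[OF AB])
  finally show ?Q unfolding scale2 by (simp add: A_def B_def)
qed

text \<open>
  In the inductive step over the coordinates, \<open>D\<close> is the sum over tuples with no factor \<open>p\<close> in the
  coordinates treated so far, \<open>Q\<close> the one without a factor \<open>p\<^sup>2\<close>, \<open>G = Q - D\<close> and \<open>x = 1/p\<close>; the indices
  1 and 2 mark values at the region shifted once or twice by \<open>ln p\<close>. That \<open>G\<close> is itself of size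
  \<open>O(x)\<close> is what makes the error of \<open>Q\<close> grow only by \<open>O(x\<^sup>2)\<close>.
\<close>

lemma sieve_error_step:
  fixes x V V1 V2 D D1 D2 G G1 Q K M M0 \<eta> :: real and j :: nat
  defines "d \<equiv> K * (1 - x) ^ j" and "g \<equiv> K * (real j * x) * (1 - x) ^ j"
  assumes x: "0 \<le> x" "x \<le> 1 / 2" and K: "0 \<le> K" "K \<le> 1"
    and \<eta>: "0 \<le> \<eta>" "\<eta> \<le> M" "\<bar>V1 - V\<bar> \<le> \<eta>" "\<bar>V2 - V\<bar> \<le> 2 * \<eta>"
    and D: "\<bar>D - d * V\<bar> \<le> 3 ^ j * M" "\<bar>D1 - d * V1\<bar> \<le> 3 ^ j * M" "\<bar>D2 - d * V2\<bar> \<le> 3 ^ j * M"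
    and G: "\<bar>G - g * V\<bar> \<le> 8 ^ j * M * x" "\<bar>G1 - g * V1\<bar> \<le> 8 ^ j * M * x"
    and Q: "\<bar>Q - K * ((1 - x) ^ j * (1 + real j * x)) * V\<bar> \<le> M0 + 8 ^ j * M * x ^ 2"
  shows "\<bar>(D - D1 * x) - K * (1 - x) ^ Suc j * V\<bar> \<le> 3 ^ Suc j * M"
    and "\<bar>(G - G1 * x + D1 * x - D2 * x ^ 2) - K * (real (Suc j) * x) * (1 - x) ^ Suc j * V\<bar> \<le> 8 ^ Suc j * M * x"
    and "\<bar>(Q - G1 * x - D2 * x ^ 2) - K * ((1 - x) ^ Suc j * (1 + real (Suc j) * x)) * V\<bar> \<le> M0 + 8 ^ Suc j * M * x ^ 2"
proof -
  have M: "0 \<le> M" using \<eta> by simp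
  have pw: "0 \<le> (1 - x) ^ j" "(1 - x) ^ j \<le> 1" using x by (auto intro: power_le_one)
  have d: "0 \<le> d" "d \<le> 1" using K pw by (auto simp: d_def intro: mult_le_one)
  have g: "0 \<le> g" "g \<le> real j * x"
  proof -
    show "0 \<le> g" using K pw x by (simp add: g_def)
    have "g = (K * (1 - x) ^ j) * (real j * x)" by (simp add: g_def)
    also have "\<dots> \<le> 1 * (real j * x)" using d x by (intro mult_right_mono) (auto simp: d_def)
    finally show "g \<le> real j * x" by simp
  qed
  have dV: "\<bar>d * (V1 - V)\<bar> \<le> M" "\<bar>d * (V2 - V)\<bar> \<le> 2 * M"
  proof -
    have "\<bar>d * (V1 - V)\<bar> \<le> 1 * \<eta>" unfolding abs_mult using d \<eta> by (intro mult_mono) auto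
    then show "\<bar>d * (V1 - V)\<bar> \<le> M" using \<eta> by simp
    have "\<bar>d * (V2 - V)\<bar> \<le> 1 * (2 * \<eta>)" unfolding abs_mult using d \<eta> by (intro mult_mono) auto
    then show "\<bar>d * (V2 - V)\<bar> \<le> 2 * M" using \<eta> by simp
  qed
  have j8: "real j \<le> 8 ^ j" "(3::real) ^ j \<le> 8 ^ j" "(1::real) \<le> 8 ^ j" "(1::real) \<le> 3 ^ j"
  proof -
    have "j < 2 ^ j" by (rule less_exp)
    then have "real j < real (2 ^ j)" by (simp only: of_nat_less_iff)
    also have "real (2 ^ j) = 2 ^ j" by simp
    also have "(2::real) ^ j \<le> 8 ^ j" by (intro power_mono) auto
    finally show "real j \<le> 8 ^ j" by simp
  qed (auto intro: power_mono)
  \<comment> \<open>All errors below are measured in \<open>B\<close>. In the last two estimates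
    they add up to at most \<open>6 * B * x\<close> and, beyond \<open>M0\<close>,
    \<open>6 * B * x ^ 2\<close>, which one further factor 8 absorbs.\<close>
  define B where "B = 8 ^ j * M"
  have MB: "M \<le> B" "3 ^ j * M \<le> B" "real j * M \<le> B"
    unfolding B_def using j8 M by (auto intro: mult_right_mono simp: mult_le_cancel_right1)
  have B0: "0 \<le> B" using M by (simp add: B_def)
  have gV: "\<bar>g * (V1 - V)\<bar> \<le> B * x"
  proof -
    have "\<bar>g * (V1 - V)\<bar> \<le> (real j * x) * M" unfolding abs_mult using g \<eta> by (intro mult_mono) auto
    also have "\<dots> = real j * M * x" by simp
    also have "\<dots> \<le> B * x" using MB x by (intro mult_right_mono)
    finally show ?thesis .
  qed
  have D1: "\<bar>D1 - d * V\<bar> \<le> 3 ^ j * M + M"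
  proof -
    have "D1 - d * V = (D1 - d * V1) + d * (V1 - V)" by (simp add: algebra_simps)
    then show ?thesis using D(2) dV(1) by linarith
  qed
  have D2: "\<bar>D2 - d * V\<bar> \<le> 3 * B"
  proof -
    have "D2 - d * V = (D2 - d * V2) + d * (V2 - V)" by (simp add: algebra_simps)
    then show ?thesis using D(3) dV(2) MB by linarith
  qed
  have G1: "\<bar>G1 - g * V\<bar> \<le> 2 * B * x"
  proof -
    have "G1 - g * V = (G1 - g * V1) + g * (V1 - V)" by (simp add: algebra_simps)
    then show ?thesis using G(2) gV unfolding B_def by linarith
  qed
  have xx: "x ^ 2 \<le> x / 2" using mult_left_mono[OF x(2) x(1)] by (simp add: power2_eq_square)
  have mulx: "\<bar>z * x\<bar> \<le> c * x" if "\<bar>z\<bar> \<le> c" for z c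
    using that x by (simp add: abs_mult mult_right_mono)
  have mulxx: "\<bar>z * x ^ 2\<bar> \<le> c * x ^ 2" if "\<bar>z\<bar> \<le> c" for z c
    using that x by (simp add: abs_mult mult_right_mono)
  have half: "c * x \<le> c / 2" if "c \<ge> 0" for c using mult_left_mono[OF x(2) that] by simp
  have Bxx: "B * x ^ 2 \<le> B * x / 2" using mult_left_mono[OF xx B0] by simp
  have Bx0: "0 \<le> B * x" using B0 x by simp
  show "\<bar>(D - D1 * x) - K * (1 - x) ^ Suc j * V\<bar> \<le> 3 ^ Suc j * M"
  proof -
    have "(D - D1 * x) - K * (1 - x) ^ Suc j * V = (D - d * V) - (D1 - d * V) * x"
      by (simp add: d_def algebra_simps)
    moreover have "\<bar>(D1 - d * V) * x\<bar> \<le> (3 ^ j * M + M) / 2"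
      using mulx[OF D1] half[of "3 ^ j * M + M"] M by simp
    moreover have "M \<le> 3 ^ j * M" using j8(4) M by (simp add: mult_le_cancel_right1)
    ultimately show ?thesis using D(1) by simp
  qed
  show "\<bar>(G - G1 * x + D1 * x - D2 * x ^ 2) - K * (real (Suc j) * x) * (1 - x) ^ Suc j * V\<bar> \<le> 8 ^ Suc j * M * x"
  proof -
    \<comment> \<open>The main terms combine as \<open>(g + d * x) * (1 - x)\<close>, which is
      \<open>g\<close> for \<open>j + 1\<close>.\<close>
    have "(G - G1 * x + D1 * x - D2 * x ^ 2) - K * (real (Suc j) * x) * (1 - x) ^ Suc j * V
      = (G - g * V) - (G1 - g * V) * x + (D1 - d * V) * x - (D2 - d * V) * x ^ 2"
      by (simp add: d_def g_def algebra_simps power2_eq_square)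
    moreover have "\<bar>(G1 - g * V) * x\<bar> \<le> B * x"
      using mulx[OF G1] half[of "2 * B * x"] Bx0 by simp
    moreover have "\<bar>(D1 - d * V) * x\<bar> \<le> 2 * B * x" by (rule mulx) (use D1 MB in linarith)
    moreover have "\<bar>(D2 - d * V) * x ^ 2\<bar> \<le> 3 * B * x ^ 2" by (rule mulxx[OF D2])
    moreover have "8 ^ Suc j * M * x = 8 * (B * x)" by (simp add: B_def)
    ultimately show ?thesis using G(1) Bxx Bx0 unfolding B_def[symmetric] by linarith
  qed
  show "\<bar>(Q - G1 * x - D2 * x ^ 2) - K * ((1 - x) ^ Suc j * (1 + real (Suc j) * x)) * V\<bar> \<le> M0 + 8 ^ Suc j * M * x ^ 2"
  proof -
    \<comment> \<open>The main terms rest on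
      \<open>1 + j * x - (j + 1) * x ^ 2 = (1 - x) * (1 + (j + 1) * x)\<close>. No error of order
      \<open>x\<close> appears: the only quantity multiplied by a single \<open>x\<close> is
      \<open>G1\<close>, whose error already contains a factor \<open>x\<close>.\<close>
    have "(Q - G1 * x - D2 * x ^ 2) - K * ((1 - x) ^ Suc j * (1 + real (Suc j) * x)) * V
      = (Q - K * ((1 - x) ^ j * (1 + real j * x)) * V) - (G1 - g * V) * x - (D2 - d * V) * x ^ 2"
      by (simp add: d_def g_def algebra_simps power2_eq_square)
    moreover have "\<bar>(G1 - g * V) * x\<bar> \<le> 2 * (B * x ^ 2)"
      using mulx[OF G1] by (simp add: power2_eq_square mult_ac)
    moreover have "\<bar>(D2 - d * V) * x ^ 2\<bar> \<le> 3 * (B * x ^ 2)" using mulxx[OF D2] by (simp add: mult_ac)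
    moreover have "8 ^ Suc j * M * x ^ 2 = 8 * (B * x ^ 2)" by (simp add: B_def)
    moreover have "0 \<le> B * x ^ 2" using B0 by simp
    ultimately show ?thesis using Q unfolding B_def[symmetric] by linarith
  qed
qed

text \<open>The recursion for \<open>Q\<close> involves \<open>D\<close> and \<open>Q - D\<close> at
  translated arguments, so the induction over the inspected coordinates carries estimates for all
  three, uniformly in \<alpha>, \<beta> \<le> \<open>L\<close>. Here \<open>K\<close> is the product
  of the Euler factors found so far and \<eta> the variation of \<open>V\<close> under one
  translation belonging to \<open>p\<close>.\<close>

lemma sieve_step:
  assumes I: "finite I" "I \<subseteq> {1..<k}" and p: "prime p"
    and \<Omega>: "\<And>(a :: nat \<Rightarrow> nat) i. a \<in> I \<rightarrow>\<^sub>E {1..} \<Longrightarrow> i \<in> I \<Longrightarrow> a(i := p * a i) \<in> \<Omega> \<longleftrightarrow> a \<in> \<Omega>"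
    and K: "0 \<le> K" "K \<le> 1" and M0: "0 \<le> M0" and \<eta>: "0 \<le> \<eta>"
    and W: "\<And>\<alpha> \<beta>. \<alpha> \<le> L \<Longrightarrow> \<beta> \<le> L \<Longrightarrow> \<bar>wsum k I \<Omega> \<alpha> \<beta> - K * V \<alpha> \<beta>\<bar> \<le> M0"
    and V: "\<And>\<alpha> \<beta> i s. \<alpha> \<le> L \<Longrightarrow> \<beta> \<le> L \<Longrightarrow> i \<in> I \<Longrightarrow> 0 \<le> s \<Longrightarrow>
      \<bar>V (\<alpha> - s * (real i * ln (real p))) (\<beta> - s * ((real k - real i) * ln (real p))) - V \<alpha> \<beta>\<bar> \<le> s * \<eta>"
    and L: "\<alpha> \<le> L" "\<beta> \<le> L"
  shows "\<bar>wsum k I (\<Omega> \<inter> pfree (p ^ 2) I) \<alpha> \<beta> - K * ((1 - 1 / real p) ^ card I * (1 + real (card I) / real p)) * V \<alpha> \<beta>\<bar>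
    \<le> M0 + 8 ^ card I * (M0 + \<eta>) / real p ^ 2"
proof -
  define x where "x = 1 / real p"
  define M where "M = M0 + \<eta>"
  define D where "D = (\<lambda>J. wsum k I (\<Omega> \<inter> pfree p J))"
  define Q where "Q = (\<lambda>J. wsum k I (\<Omega> \<inter> pfree (p ^ 2) J))"
  have p2: "p \<ge> 2" using p prime_ge_2_nat by blast
  have x: "0 \<le> x" "x \<le> 1 / 2" using p2 by (auto simp: x_def field_simps)
  have lnp: "0 \<le> ln (real p)" using p2 by simp
  have main: "(\<forall>\<alpha>\<le>L. \<forall>\<beta>\<le>L. \<bar>D J \<alpha> \<beta> - K * (1 - x) ^ card J * V \<alpha> \<beta>\<bar> \<le> 3 ^ card J * M \<and>
     \<bar>(Q J \<alpha> \<beta> - D J \<alpha> \<beta>) - K * (real (card J) * x) * (1 - x) ^ card J * V \<alpha> \<beta>\<bar> \<le> 8 ^ card J * M * x \<and>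
     \<bar>Q J \<alpha> \<beta> - K * ((1 - x) ^ card J * (1 + real (card J) * x)) * V \<alpha> \<beta>\<bar> \<le> M0 + 8 ^ card J * M * x ^ 2)"
    if "J \<subseteq> I" for J
    using finite_subset[OF that I(1)] that
  proof (induction J rule: finite_induct)
    case empty
    have "pfree p {} = UNIV" "pfree (p ^ 2) {} = UNIV" using p2 by (auto simp: pfree_def)
    then have DQ: "D {} = wsum k I \<Omega>" "Q {} = wsum k I \<Omega>" by (simp_all add: D_def Q_def)
    have "0 \<le> M * x" "M0 \<le> M0 + M * x ^ 2" "M0 \<le> M" using x M0 \<eta> by (auto simp: M_def)
    note pos = this
    show ?case unfolding DQ
    proof (intro allI impI)
      fix \<alpha> \<beta> assume "\<alpha> \<le> L" "\<beta> \<le> L"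
      note Wab = W[OF this]
      then have "\<bar>wsum k I \<Omega> \<alpha> \<beta> - K * V \<alpha> \<beta>\<bar> \<le> M0 + M * x ^ 2" using pos(2) by (rule order_trans)
      then show "\<bar>wsum k I \<Omega> \<alpha> \<beta> - K * (1 - x) ^ card {} * V \<alpha> \<beta>\<bar> \<le> 3 ^ card {} * M \<and>
        \<bar>(wsum k I \<Omega> \<alpha> \<beta> - wsum k I \<Omega> \<alpha> \<beta>) - K * (real (card {}) * x) * (1 - x) ^ card {} * V \<alpha> \<beta>\<bar> \<le> 8 ^ card {} * M * x \<and>
        \<bar>wsum k I \<Omega> \<alpha> \<beta> - K * ((1 - x) ^ card {} * (1 + real (card {}) * x)) * V \<alpha> \<beta>\<bar> \<le> M0 + 8 ^ card {} * M * x ^ 2"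
        using pos(1) order_trans[OF Wab pos(3)]
        by (simp only: card.empty power_0 mult_1 mult_1_right of_nat_0 mult_zero_left mult_zero_right add_0_right diff_self diff_zero abs_zero)
    qed
  next
    case (insert i J)
    have iI: "i \<in> I" and J: "J \<subseteq> I" using insert.prems by auto
    note IH = insert.IH[OF J, rule_format]
    have c: "card (insert i J) = Suc (card J)" using insert.hyps by simp
    have ik: "0 \<le> real i * ln (real p)" "0 \<le> (real k - real i) * ln (real p)"
      using iI I lnp by auto
    show ?case
    proof (intro allI impI)
      fix \<alpha> \<beta> assume ab: "\<alpha> \<le> L" "\<beta> \<le> L"
      define a where "a = (\<lambda>s. \<alpha> - s * (real i * ln (real p)))"
      define b where "b = (\<lambda>s. \<beta> - s * ((real k - real i) * ln (real p)))"
      have ab0: "a 0 = \<alpha>" "b 0 = \<beta>" by (simp_all add: a_def b_def)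
      have abs: "a s \<le> L" "b s \<le> L" if "s \<ge> 0" for s
        using ab mult_nonneg_nonneg[OF that ik(1)] mult_nonneg_nonneg[OF that ik(2)]
        by (auto simp: a_def b_def)
      have DV: "\<bar>D J (a s) (b s) - K * (1 - x) ^ card J * V (a s) (b s)\<bar> \<le> 3 ^ card J * M" if "s \<ge> 0" for s
        using IH[OF abs[OF that]] by blast
      have GV: "\<bar>(Q J (a s) (b s) - D J (a s) (b s)) - K * (real (card J) * x) * (1 - x) ^ card J * V (a s) (b s)\<bar>
        \<le> 8 ^ card J * M * x" if "s \<ge> 0" for s
        using IH[OF abs[OF that]] by blast
      have QV: "\<bar>Q J \<alpha> \<beta> - K * ((1 - x) ^ card J * (1 + real (card J) * x)) * V \<alpha> \<beta>\<bar> \<le> M0 + 8 ^ card J * M * x ^ 2"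
        using IH[OF ab] by blast
      have VV: "\<bar>V (a 1) (b 1) - V \<alpha> \<beta>\<bar> \<le> \<eta>" "\<bar>V (a 2) (b 2) - V \<alpha> \<beta>\<bar> \<le> 2 * \<eta>"
        using V[OF ab iI, of 1] V[OF ab iI, of 2] by (simp_all add: a_def b_def)
      have \<eta>M: "\<eta> \<le> M" using M0 by (simp add: M_def)
      note rec = wsum_pfree_insert[OF I J iI insert.hyps(2) p \<Omega>,
          of "\<lambda>X s. wsum k I (\<Omega> \<inter> X) (\<alpha> - s * (real i * ln (real p))) (\<beta> - s * ((real k - real i) * ln (real p)))" \<alpha> \<beta>]
      have Drec: "D (insert i J) \<alpha> \<beta> = D J \<alpha> \<beta> - D J (a 1) (b 1) * x"
        using rec(1) by (simp add: D_def a_def b_def x_def)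
      have Qrec: "Q (insert i J) \<alpha> \<beta> = Q J \<alpha> \<beta> - (Q J (a 1) (b 1) - D J (a 1) (b 1)) * x - D J (a 2) (b 2) * x ^ 2"
        using rec(2) by (simp add: D_def Q_def a_def b_def x_def power_divide)
      have Grec: "Q (insert i J) \<alpha> \<beta> - D (insert i J) \<alpha> \<beta> = (Q J \<alpha> \<beta> - D J \<alpha> \<beta>)
         - (Q J (a 1) (b 1) - D J (a 1) (b 1)) * x + D J (a 1) (b 1) * x - D J (a 2) (b 2) * x ^ 2"
        unfolding Drec Qrec by simp

      show "\<bar>D (insert i J) \<alpha> \<beta> - K * (1 - x) ^ card (insert i J) * V \<alpha> \<beta>\<bar> \<le> 3 ^ card (insert i J) * M \<and>
        \<bar>(Q (insert i J) \<alpha> \<beta> - D (insert i J) \<alpha> \<beta>) - K * (real (card (insert i J)) * x) * (1 - x) ^ card (insert i J) * V \<alpha> \<beta>\<bar>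
           \<le> 8 ^ card (insert i J) * M * x \<and>
        \<bar>Q (insert i J) \<alpha> \<beta> - K * ((1 - x) ^ card (insert i J) * (1 + real (card (insert i J)) * x)) * V \<alpha> \<beta>\<bar>
           \<le> M0 + 8 ^ card (insert i J) * M * x ^ 2"
        unfolding c Grec
        unfolding Drec Qrec
        by (intro conjI sieve_error_step[OF x K \<eta> \<eta>M VV DV[of 0, unfolded ab0] DV[of 1] DV[of 2]
          GV[of 0, unfolded ab0] GV[of 1] QV]) simp_all
    qed
  qed
  show ?thesis using main[OF order_refl] L by (simp add: Q_def x_def M_def power_divide)
qed

section \<open>Sieving by all primes\<close>

definition euler_factor :: "nat \<Rightarrow> nat \<Rightarrow> real" where
  "euler_factor r p = (if prime p then (1 - 1 / real p) ^ r * (1 + real r / real p) else 1)"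

definition sqfree_upto :: "nat \<Rightarrow> nat set \<Rightarrow> (nat \<Rightarrow> nat) set" where
  "sqfree_upto N I = {a. \<forall>p<N. prime p \<longrightarrow> \<not> p ^ 2 dvd (\<Prod>j\<in>I. a j)}"

lemma sqfree_upto_Suc:
  "sqfree_upto (Suc N) I = (if prime N then sqfree_upto N I \<inter> pfree (N ^ 2) I else sqfree_upto N I)"
  by (auto simp: sqfree_upto_def pfree_def less_Suc_eq)

text \<open>A new prime \<open>N\<close> is coprime to the squares of all smaller primes. This is
  the stability under multiplication that \<open>sieve_step\<close> demands of \<Omega>.\<close>

lemma sqfree_upto_scale:
  assumes "finite I" "i \<in> I" "prime N"
  shows "a(i := N * a i) \<in> sqfree_upto N I \<longleftrightarrow> a \<in> sqfree_upto N I"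
proof -
  have "(\<Prod>j\<in>I - {i}. (a(i := N * a i)) j) = (\<Prod>j\<in>I - {i}. a j)" by (rule prod.cong) auto
  then have P: "(\<Prod>j\<in>I. (a(i := N * a i)) j) = N * (\<Prod>j\<in>I. a j)"
    using assms by (simp add: prod.remove[of I i] mult.assoc)
  have "p ^ 2 dvd N * m \<longleftrightarrow> p ^ 2 dvd m" if "p < N" "prime p" for p m
  proof -
    have "coprime (p ^ 2) N" using that assms by (auto simp: primes_coprime)
    then show ?thesis by (simp add: coprime_dvd_mult_right_iff)
  qed
  then show ?thesis unfolding sqfree_upto_def mem_Collect_eq P by blast
qed

text \<open>Bernoulli's inequality bounds the factor by \<open>(1 - x ^ 2) ^ r\<close> with
  \<open>x = 1/p\<close>. Staying in \<open>[0, 1]\<close> makes every partial product an admissible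
  \<open>K\<close> for \<open>sieve_step\<close>.\<close>

lemma euler_factor_bounds: "0 \<le> euler_factor r p" "euler_factor r p \<le> 1"
proof -
  show "0 \<le> euler_factor r p"
    by (auto simp: euler_factor_def dest: prime_ge_1_nat intro!: mult_nonneg_nonneg)
  show "euler_factor r p \<le> 1"
  proof (cases "prime p")
    case True
    define x where "x = 1 / real p"
    have x: "0 \<le> x" "x \<le> 1" using prime_ge_1_nat[OF True] by (auto simp: x_def)
    have "(1 - x) ^ r * (1 + real r * x) \<le> (1 - x) ^ r * (1 + x) ^ r"
      using x Bernoulli_inequality[of x r] by (intro mult_left_mono) auto
    also have "\<dots> = (1 - x * x) ^ r" by (simp add: power_mult_distrib[symmetric] algebra_simps)
    also have "\<dots> \<le> 1" using x by (intro power_le_one) (auto intro: mult_le_one)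
    finally show ?thesis using True by (simp add: euler_factor_def x_def)
  qed (simp add: euler_factor_def)
qed

text \<open>Trades the logarithm for half a power, which leaves a summable exponent.\<close>

lemma one_plus_ln_le:
  assumes "x \<ge> (1::real)"
  shows "(1 + ln x) / x ^ 2 \<le> 2 * x powr (- 3 / 2)"
proof -
  have "ln (sqrt x) \<le> sqrt x - 1" using assms by (intro ln_le_minus_one) auto
  then have "1 + ln x \<le> 2 * sqrt x" using assms by (simp add: ln_sqrt)
  then have "(1 + ln x) / x ^ 2 \<le> 2 * sqrt x / x ^ 2" by (rule divide_right_mono) simp
  also have "\<dots> = 2 * (x powr (1 / 2) / x powr 2)"
    using assms by (simp add: powr_half_sqrt)
  also have "x powr (1 / 2) / x powr 2 = x powr (- 3 / 2)" by (simp add: powr_diff[symmetric])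
  finally show ?thesis .
qed

lemma prod_one_plus_bounded:
  fixes f :: "nat \<Rightarrow> real"
  assumes "summable f" "\<And>n. f n \<ge> 0"
  shows "(\<Prod>n<N. 1 + f n) \<le> exp (suminf f)"
proof -
  have "(\<Prod>n<N. 1 + f n) \<le> (\<Prod>n<N. exp (f n))"
    using assms by (intro prod_mono) (auto intro: add_nonneg_nonneg)
  also have "\<dots> = exp (\<Sum>n<N. f n)" by (simp add: exp_sum)
  also have "\<dots> \<le> exp (suminf f)" using assms by (auto intro: sum_le_suminf)
  finally show ?thesis .
qed

text \<open>The essential point is that \<open>C\<close> does not depend on \<open>N\<close>. Each
  prime multiplies the error by at most \<open>1 + f p\<close> with summable \<open>f\<close>, so
  the product of these factors is bounded.\<close>

lemma wsum_sqfree_upto: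
  assumes I: "finite I" "I \<noteq> {}" "I \<subseteq> {1..<k}"
  shows "\<exists>C\<ge>0. \<forall>N. \<forall>L\<ge>0. \<forall>\<alpha>\<le>L. \<forall>\<beta>\<le>L. \<bar>wsum k I (sqfree_upto N I) \<alpha> \<beta> - (\<Prod>p<N. euler_factor (card I) p) * vol k I \<alpha> \<beta>\<bar>
     \<le> C * (1 + L) ^ (card I - 1)"
proof -
  define r where "r = card I"
  obtain C where C0: "C \<ge> 0" and C: "\<forall>L\<ge>0. \<forall>\<alpha>\<le>L. \<forall>\<beta>\<le>L.
    \<bar>wsum k I UNIV \<alpha> \<beta> - vol k I \<alpha> \<beta>\<bar> \<le> C * (1 + L) ^ (r - 1)"
    using wsum_vol[OF I] unfolding r_def by (elim exE conjE)
  obtain D where D0: "D \<ge> 0" and D: "\<forall>L\<ge>0. \<forall>\<alpha>\<le>L. \<forall>\<beta>\<le>L. \<forall>\<alpha>'\<le>L. \<forall>\<beta>'\<le>L.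
    \<bar>vol k I \<alpha> \<beta> - vol k I \<alpha>' \<beta>'\<bar> \<le> D * (1 + L) ^ (r - 1) * (\<bar>\<alpha> - \<alpha>'\<bar> + \<bar>\<beta> - \<beta>'\<bar>)"
    using vol_Lipschitz[OF I] unfolding r_def by (elim exE conjE)
  \<comment> \<open>The factor \<open>8 ^ r\<close> stems from \<open>sieve_step\<close>,
    \<open>1 + D * k\<close> from absorbing \<eta> into the current error, and 2 from
    \<open>one_plus_ln_le\<close>.\<close>
  define c where "c = 8 ^ r * (1 + D * real k) * 2"
  define f where "f = (\<lambda>n::nat. c * real n powr (- 3 / 2))"
  have c0: "c \<ge> 0" using D0 by (simp add: c_def)
  have f0: "f n \<ge> 0" for n using c0 by (simp add: f_def)
  have sf: "summable f" unfolding f_def by (intro summable_mult) (simp add: summable_real_powr_iff)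
  \<comment> \<open>Starting from \<open>C + 1\<close> keeps \<open>E N \<ge> 1\<close>, so the
    additive contribution of \<eta> can be charged to \<open>E N\<close> as a multiplicative
    one.\<close>
  define E where "E = (\<lambda>N. (C + 1) * (\<Prod>n<N. 1 + f n))"
  have E1: "E N \<ge> 1" for N
  proof -
    have "(\<Prod>n<N. 1 + f n) \<ge> 1" using f0 by (intro prod_ge_1) auto
    then have "1 * 1 \<le> E N" unfolding E_def using C0 by (intro mult_mono) auto
    then show ?thesis by simp
  qed
  have main: "\<bar>wsum k I (sqfree_upto N I) \<alpha> \<beta> - (\<Prod>p<N. euler_factor r p) * vol k I \<alpha> \<beta>\<bar>
     \<le> E N * (1 + L) ^ (r - 1)" if L: "L \<ge> 0" and "\<alpha> \<le> L" "\<beta> \<le> L" for N L \<alpha> \<beta>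
    using that(2,3)
  proof (induction N arbitrary: \<alpha> \<beta>)
    case 0
    have "sqfree_upto 0 I = UNIV" by (simp add: sqfree_upto_def)
    moreover have "C * (1 + L) ^ (r - 1) \<le> E 0 * (1 + L) ^ (r - 1)"
      using L by (intro mult_right_mono) (auto simp: E_def)
    ultimately show ?case using C[rule_format, OF L 0] by simp
  next
    case (Suc N)
    define P where "P = (1 + L) ^ (r - 1)"
    have P: "P \<ge> 0" using L by (simp add: P_def)
    have ES: "E N * P \<le> E (Suc N) * P"
      using P E1[of N] f0[of N] C0 mult_right_mono[of 1 "1 + f N" "E N"]
      by (intro mult_right_mono) (auto simp: E_def mult_ac)
    show ?case
    proof (cases "prime N")
      case False
      then show ?thesis using Suc.IH[OF Suc.prems] ES
        by (simp add: sqfree_upto_Suc euler_factor_def P_def)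
    next
      case True
      \<comment> \<open>The two bounds move by \<open>i * ln N\<close> and
        \<open>(k - i) * ln N\<close>, in total by \<open>k * ln N\<close> whatever the
        coordinate.\<close>
      define \<eta> where "\<eta> = D * P * (real k * ln (real N))"
      have N1: "N \<ge> 1" using True prime_ge_1_nat by blast
      have \<eta>0: "\<eta> \<ge> 0" using D0 P N1 by (simp add: \<eta>_def)
      have K: "0 \<le> (\<Prod>p<N. euler_factor r p)" "(\<Prod>p<N. euler_factor r p) \<le> 1"
        using euler_factor_bounds by (auto intro: prod_nonneg prod_le_1)
      have VV: "\<bar>vol k I (\<alpha> - s * (real i * ln (real N))) (\<beta> - s * ((real k - real i) * ln (real N))) - vol k I \<alpha> \<beta>\<bar> \<le> s * \<eta>"
        if ab: "\<alpha> \<le> L" "\<beta> \<le> L" "i \<in> I" "0 \<le> s" for \<alpha> \<beta> i s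
      proof -
        have ik: "0 \<le> real i" "0 \<le> real k - real i" using ab I by auto
        have nn: "0 \<le> s * (real i * ln (real N))" "0 \<le> s * ((real k - real i) * ln (real N))"
          using ab ik N1 by auto
        have "\<bar>vol k I (\<alpha> - s * (real i * ln (real N))) (\<beta> - s * ((real k - real i) * ln (real N))) - vol k I \<alpha> \<beta>\<bar>
          \<le> D * P * (\<bar>(\<alpha> - s * (real i * ln (real N))) - \<alpha>\<bar> + \<bar>(\<beta> - s * ((real k - real i) * ln (real N))) - \<beta>\<bar>)"
          unfolding P_def by (rule D[rule_format, OF L]) (use ab nn in auto)
        also have "\<bar>(\<alpha> - s * (real i * ln (real N))) - \<alpha>\<bar> + \<bar>(\<beta> - s * ((real k - real i) * ln (real N))) - \<beta>\<bar>
          = s * (real i * ln (real N)) + s * ((real k - real i) * ln (real N))" using nn by linarith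
        also have "\<dots> = s * (real k * ln (real N))" by (simp add: algebra_simps)
        finally show ?thesis by (simp add: \<eta>_def mult_ac)
      qed
      have step: "\<bar>wsum k I (sqfree_upto N I \<inter> pfree (N ^ 2) I) \<alpha> \<beta>
          - (\<Prod>p<N. euler_factor r p) * ((1 - 1 / real N) ^ card I * (1 + real (card I) / real N)) * vol k I \<alpha> \<beta>\<bar>
        \<le> E N * P + 8 ^ card I * (E N * P + \<eta>) / real N ^ 2"
      proof (rule sieve_step[OF I(1,3) True _ K _ \<eta>0 _ VV Suc.prems])
        show "a(i := N * a i) \<in> sqfree_upto N I \<longleftrightarrow> a \<in> sqfree_upto N I"
          if "i \<in> I" for a i by (rule sqfree_upto_scale[OF I(1) that True])
        show "0 \<le> E N * P" using E1[of N] P by simp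
        show "\<bar>wsum k I (sqfree_upto N I) \<alpha> \<beta> - (\<Prod>p<N. euler_factor r p) * vol k I \<alpha> \<beta>\<bar> \<le> E N * P"
          if "\<alpha> \<le> L" "\<beta> \<le> L" for \<alpha> \<beta> using Suc.IH[OF that] by (simp add: P_def)
      qed
      have "8 ^ card I * (E N * P + \<eta>) / real N ^ 2 \<le> E N * P * f N"
      proof -
        have l0: "0 \<le> ln (real N)" using N1 by simp
        have "E N * P + \<eta> \<le> E N * P * ((1 + D * real k) * (1 + ln (real N)))"
        proof -
          have "\<eta> = 1 * (P * (D * real k * ln (real N)))" by (simp add: \<eta>_def)
          also have "\<dots> \<le> E N * (P * (D * real k * ln (real N)))"
            using E1[of N] P D0 l0 by (intro mult_right_mono) auto
          finally have "E N * P + \<eta> \<le> E N * P * (1 + D * real k * ln (real N))" by (simp add: algebra_simps)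
          also have "\<dots> \<le> E N * P * ((1 + D * real k) * (1 + ln (real N)))"
            using E1[of N] P D0 l0 by (intro mult_left_mono) (auto simp: algebra_simps)
          finally show ?thesis .
        qed
        then have "8 ^ card I * (E N * P + \<eta>) / real N ^ 2
           \<le> 8 ^ card I * (E N * P * ((1 + D * real k) * (1 + ln (real N)))) / real N ^ 2"
          by (intro divide_right_mono mult_left_mono) auto
        also have "\<dots> = (E N * P) * (8 ^ r * (1 + D * real k)) * ((1 + ln (real N)) / real N ^ 2)"
          by (simp add: r_def)
        also have "\<dots> \<le> (E N * P) * (8 ^ r * (1 + D * real k)) * (2 * real N powr (- 3 / 2))"
          using E1[of N] P D0 N1 by (intro mult_left_mono one_plus_ln_le) auto
        also have "\<dots> = E N * P * f N" by (simp add: f_def c_def)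
        finally show ?thesis .
      qed
      then have "E N * P + 8 ^ card I * (E N * P + \<eta>) / real N ^ 2 \<le> E N * P + E N * P * f N" by simp
      also have "\<dots> = E (Suc N) * P" by (simp add: E_def algebra_simps)
      finally show ?thesis using order_trans[OF step] True
        by (simp add: sqfree_upto_Suc euler_factor_def P_def r_def mult.assoc)
    qed
  qed
  show ?thesis
  proof (intro exI[of _ "(C + 1) * exp (suminf f)"] conjI allI impI)
    fix N and L \<alpha> \<beta> :: real assume L: "0 \<le> L" "\<alpha> \<le> L" "\<beta> \<le> L"
    have "E N \<le> (C + 1) * exp (suminf f)" unfolding E_def
      using C0 by (intro mult_left_mono prod_one_plus_bounded sf f0) auto
    then have "E N * (1 + L) ^ (r - 1) \<le> (C + 1) * exp (suminf f) * (1 + L) ^ (r - 1)"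
      using L by (intro mult_right_mono) auto
    then show "\<bar>wsum k I (sqfree_upto N I) \<alpha> \<beta> - (\<Prod>p<N. euler_factor (card I) p) * vol k I \<alpha> \<beta>\<bar>
       \<le> (C + 1) * exp (suminf f) * (1 + L) ^ (card I - 1)"
      using main[OF L, of N] unfolding r_def by linarith
  qed (use C0 in auto)
qed

text \<open>Bernoulli's inequality at \<open>- 1/p\<close> gives the lower bound
  \<open>(1 - r/p) * (1 + r/p) = 1 - r^2 / p^2\<close> for the factor, so the product converges
  absolutely and its value is the limit of the partial products.\<close>

lemma euler_const_LIMSEQ:
  assumes "k \<ge> 1"
  shows "(\<lambda>N. \<Prod>p<N. euler_factor (k - 1) p) \<longlonglongrightarrow> euler_const k"
proof -
  define r where "r = k - 1"
  have r: "real k - 1 = real r" using assms by (simp add: r_def)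
  have ec: "euler_const k = (\<Prod>p. euler_factor r p)"
    unfolding euler_const_def euler_factor_def r_def[symmetric] r by simp
  have "summable (\<lambda>p. norm (euler_factor r p - 1))"
  proof (rule summable_comparison_test')
    show "summable (\<lambda>p::nat. real r ^ 2 * (1 / real p ^ 2))"
      by (intro summable_mult) (use inverse_power_summable[of 2] in \<open>simp add: inverse_eq_divide\<close>)
    fix p :: nat assume "p \<ge> 0"
    show "norm (norm (euler_factor r p - 1)) \<le> real r ^ 2 * (1 / real p ^ 2)"
    proof (cases "prime p")
      case True
      define x where "x = 1 / real p"
      have x: "0 \<le> x" "x \<le> 1" using prime_ge_1_nat[OF True] by (auto simp: x_def)
      have "1 - real r * x \<le> (1 - x) ^ r" using Bernoulli_inequality[of "- x" r] x by simp
      then have "(1 - real r * x) * (1 + real r * x) \<le> (1 - x) ^ r * (1 + real r * x)"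
        using x by (intro mult_right_mono) auto
      moreover have "(1 - real r * x) * (1 + real r * x) = 1 - real r ^ 2 * x ^ 2"
        by (simp add: algebra_simps power2_eq_square)
      moreover have "(1 - x) ^ r * (1 + real r * x) = euler_factor r p"
        using True by (simp add: euler_factor_def x_def)
      ultimately show ?thesis using euler_factor_bounds(2)[of r p] by (simp add: x_def power_divide)
    qed (simp add: euler_factor_def)
  qed
  then have "convergent_prod (euler_factor r)"
    by (intro abs_convergent_prod_imp_convergent_prod summable_imp_abs_convergent_prod)
  then have "(\<lambda>N. \<Prod>p\<le>N. euler_factor r p) \<longlonglongrightarrow> euler_const k"
    unfolding ec by (rule convergent_prod_LIMSEQ)
  then have "(\<lambda>N. \<Prod>p<Suc N. euler_factor r p) \<longlonglongrightarrow> euler_const k"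
    by (simp add: lessThan_Suc_atMost)
  then show ?thesis unfolding r_def by (rule LIMSEQ_imp_Suc)
qed

section \<open>Parametrisation of the pairs\<close>

text \<open>Local picture at one prime: \<open>m i\<close> is its exponent in the entry
  \<open>i\<close> of a squarefree tuple, so at most one of these is 1, and \<open>s\<close> is the
  position, or 0 if there is none. The final \<open>mod k\<close> only serves the case
  \<open>s = 0\<close>.\<close>

lemma exponent_pattern:
  fixes m :: "nat \<Rightarrow> nat"
  assumes "I \<subseteq> {1..<k}" "finite I" "(\<Sum>i\<in>I. m i) \<le> 1" "k > 0"
  defines "s \<equiv> \<Sum>i\<in>I. i * m i"
  shows "s < k" "\<And>i. i \<in> I \<Longrightarrow> m i = (if s = i then 1 else 0)"
    "(\<Sum>i\<in>I. (k - i) * m i) = (k - s) mod k"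
proof -
  have "s < k \<and> (\<forall>i\<in>I. m i = (if s = i then 1 else 0)) \<and> (\<Sum>i\<in>I. (k - i) * m i) = (k - s) mod k"
  proof (cases "\<forall>i\<in>I. m i = 0")
    case True
    then have "s = 0" "(\<Sum>i\<in>I. (k - i) * m i) = 0" by (auto simp: s_def)
    then show ?thesis using True assms by auto
  next
    case False
    then obtain j where j: "j \<in> I" "m j > 0" by auto
    have "m j + (\<Sum>i\<in>I - {j}. m i) \<le> 1" using assms(2,3) j by (simp add: sum.remove)
    then have mj: "m j = 1" and "(\<Sum>i\<in>I - {j}. m i) = 0" using j by auto
    then have m0: "m i = 0" if "i \<in> I - {j}" for i using that assms(2) by auto
    have sel: "(\<Sum>i\<in>I. g i * m i) = g j" for g :: "nat \<Rightarrow> nat"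
    proof -
      have "(\<Sum>i\<in>I - {j}. g i * m i) = 0" using m0 by (intro sum.neutral) auto
      then show ?thesis using assms(2) j mj by (simp add: sum.remove)
    qed
    have "s = j" unfolding s_def by (rule sel)
    moreover have "0 < j" "j < k" using j assms(1) by auto
    ultimately show ?thesis using m0 mj sel[of "\<lambda>i. k - i"] by auto
  qed
  then show "s < k" "\<And>i. i \<in> I \<Longrightarrow> m i = (if s = i then 1 else 0)"
    "(\<Sum>i\<in>I. (k - i) * m i) = (k - s) mod k" by auto
qed

lemma multiplicity_prod_powers:
  fixes a :: "nat \<Rightarrow> nat"
  assumes "finite I" "\<And>i. i \<in> I \<Longrightarrow> a i > 0" "prime p"
  shows "multiplicity p (\<Prod>i\<in>I. a i ^ e i) = (\<Sum>i\<in>I. e i * multiplicity p (a i))"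
proof -
  have nz: "\<forall>i\<in>I. a i \<noteq> 0" using assms(2) by fastforce
  have "multiplicity p (\<Prod>i\<in>I. a i ^ e i) = (\<Sum>i\<in>I. multiplicity p (a i ^ e i))"
    using assms(1,3) nz by (intro prime_elem_multiplicity_prod_distrib) auto
  also have "\<dots> = (\<Sum>i\<in>I. e i * multiplicity p (a i))"
    using assms(3) nz by (intro sum.cong) (auto simp: prime_elem_multiplicity_power_distrib)
  finally show ?thesis .
qed

lemma squarefree_prod_iff:
  fixes a :: "nat \<Rightarrow> nat"
  assumes "finite I" "\<And>i. i \<in> I \<Longrightarrow> a i > 0"
  shows "squarefree (\<Prod>i\<in>I. a i) \<longleftrightarrow> (\<forall>p. prime p \<longrightarrow> (\<Sum>i\<in>I. multiplicity p (a i)) \<le> 1)"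
proof -
  have "(\<Prod>i\<in>I. a i) \<noteq> 0" using assms by auto
  moreover have "multiplicity p (\<Prod>i\<in>I. a i) = (\<Sum>i\<in>I. multiplicity p (a i))" if "prime p" for p
  proof -
    have "multiplicity p (\<Prod>i\<in>I. a i ^ 1) = (\<Sum>i\<in>I. 1 * multiplicity p (a i))"
      by (rule multiplicity_prod_powers) (use assms that in auto)
    then show ?thesis by simp
  qed
  ultimately show ?thesis by (auto simp: squarefree_factorial_semiring'')
qed

text \<open>All exponents of \<open>y\<close> are those of \<open>x\<close> reduced modulo
  \<open>k\<close>, so \<open>y\<close> divides \<open>x\<close> and the quotient has only exponents
  divisible by \<open>k\<close>.\<close>

lemma nth_power_cofactor:
  fixes x y :: nat
  assumes "k > 0" "x > 0" "y > 0"
    and "\<And>p. prime p \<Longrightarrow> multiplicity p y = multiplicity p x mod k"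
  shows "\<exists>c>0. x = y * c ^ k"
proof -
  have "y dvd x" by (rule multiplicity_le_imp_dvd) (use assms in auto)
  then obtain z where z: "x = y * z" by auto
  have z0: "z > 0" using z assms by auto
  have "is_nth_power k z" unfolding is_nth_power_conv_multiplicity_nat[OF assms(1)]
  proof (intro allI impI)
    fix p :: nat assume p: "prime p"
    have "multiplicity p x = multiplicity p y + multiplicity p z"
      unfolding z using p assms z0 by (simp add: prime_elem_multiplicity_mult_distrib)
    then have "multiplicity p z = k * (multiplicity p x div k)"
      using assms(4)[OF p] by (metis add_left_cancel mod_mult_div_eq)
    then show "k dvd multiplicity p z" by simp
  qed
  then obtain c where "z = c ^ k" by (auto elim: is_nth_powerE)
  moreover from this have "c \<noteq> 0" using z0 assms(1) by (metis power_0_left not_gr_zero)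
  ultimately show ?thesis using z by (intro exI[of _ c]) auto
qed

text \<open>On squarefree tuples \<open>upper_prod\<close> and \<open>lower_prod\<close> give the
  parts of the two numbers free of \<open>k\<close>-th powers: a prime in the entry \<open>i\<close>
  has exponent \<open>i\<close> modulo \<open>k\<close> in the first number and therefore
  \<open>k - i\<close> in the second.\<close>

definition upper_prod :: "nat \<Rightarrow> (nat \<Rightarrow> nat) \<Rightarrow> nat" where
  "upper_prod k a = (\<Prod>i\<in>{1..<k}. a i ^ i)"

definition lower_prod :: "nat \<Rightarrow> (nat \<Rightarrow> nat) \<Rightarrow> nat" where
  "lower_prod k a = (\<Prod>i\<in>{1..<k}. a i ^ (k - i))"

definition sqfree_tuples :: "nat \<Rightarrow> (nat \<Rightarrow> nat) set" where
  "sqfree_tuples k = {a \<in> {1..<k} \<rightarrow>\<^sub>E {1..}. squarefree (\<Prod>i\<in>{1..<k}. a i)}"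

lemma sqfree_tuples_pos: "a \<in> sqfree_tuples k \<Longrightarrow> i \<in> {1..<k} \<Longrightarrow> a i > 0"
  by (auto simp: sqfree_tuples_def PiE_iff Suc_le_eq)

lemma prod_pos_tuples:
  assumes "\<And>i. i \<in> {1..<k} \<Longrightarrow> a i > 0"
  shows "upper_prod k a > 0" "lower_prod k a > 0"
  unfolding upper_prod_def lower_prod_def using assms by (auto intro!: prod_pos)

lemma sqfree_tuples_multiplicity:
  assumes a: "a \<in> sqfree_tuples k" and p: "prime p" and k: "k > 0"
  shows "multiplicity p (upper_prod k a) < k"
    "i \<in> {1..<k} \<Longrightarrow> multiplicity p (a i) = (if multiplicity p (upper_prod k a) = i then 1 else 0)"
    "multiplicity p (lower_prod k a) = (k - multiplicity p (upper_prod k a)) mod k"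
proof -
  note pos = sqfree_tuples_pos[OF a]
  have le: "(\<Sum>i\<in>{1..<k}. multiplicity p (a i)) \<le> 1"
    using a squarefree_prod_iff[of "{1..<k}" a] pos p by (auto simp: sqfree_tuples_def)
  have u: "multiplicity p (upper_prod k a) = (\<Sum>i\<in>{1..<k}. i * multiplicity p (a i))"
    unfolding upper_prod_def by (rule multiplicity_prod_powers) (use pos p in auto)
  have l: "multiplicity p (lower_prod k a) = (\<Sum>i\<in>{1..<k}. (k - i) * multiplicity p (a i))"
    unfolding lower_prod_def by (rule multiplicity_prod_powers) (use pos p in auto)
  note pat = exponent_pattern[OF order_refl finite_atLeastLessThan le k, folded u l]
  show "multiplicity p (upper_prod k a) < k" by (rule pat(1))
  show "multiplicity p (lower_prod k a) = (k - multiplicity p (upper_prod k a)) mod k" by (rule pat(3))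
  show "i \<in> {1..<k} \<Longrightarrow> multiplicity p (a i) = (if multiplicity p (upper_prod k a) = i then 1 else 0)"
    by (rule pat(2))
qed

lemma multiplicity_mult_power:
  fixes x c p :: nat
  assumes "prime p" "x > 0" "c > 0"
  shows "multiplicity p (x * c ^ k) = multiplicity p x + k * multiplicity p c"
  using assms by (simp add: prime_elem_multiplicity_mult_distrib prime_elem_multiplicity_power_distrib)

lemma upper_lower_prod: "upper_prod k a * lower_prod k a = (\<Prod>i\<in>{1..<k}. a i) ^ k"
  unfolding upper_prod_def lower_prod_def prod.distrib[symmetric] prod_power_distrib
  by (rule prod.cong) (auto simp: power_add[symmetric])

text \<open>Everything is read off modulo \<open>k\<close>. The exponents of \<open>x1\<close>
  modulo \<open>k\<close> determine the entry in which each prime lies, hence the whole tuple; then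
  \<open>c\<close> and \<open>d\<close> are the \<open>k\<close>-th roots of the cofactors.\<close>

lemma power_pair_bij:
  assumes k: "k > 0"
  shows "bij_betw (\<lambda>(a, c, d). (upper_prod k a * c ^ k, lower_prod k a * d ^ k))
    (sqfree_tuples k \<times> {0<..} \<times> {0<..}) {(x1, x2). 0 < x1 \<and> 0 < x2 \<and> is_nth_power k (x1 * x2)}"
proof (rule bij_betwI')
  fix u v :: "(nat \<Rightarrow> nat) \<times> nat \<times> nat"
  assume uv: "u \<in> sqfree_tuples k \<times> {0<..} \<times> {0<..}" "v \<in> sqfree_tuples k \<times> {0<..} \<times> {0<..}"
  obtain a c d b e f where u: "u = (a, c, d)" "v = (b, e, f)" by (cases u; cases v) auto
  have a: "a \<in> sqfree_tuples k" "c > 0" "d > 0" and b: "b \<in> sqfree_tuples k" "e > 0" "f > 0"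
    using uv by (auto simp: u)
  have U: "upper_prod k a > 0" "upper_prod k b > 0" "lower_prod k a > 0" "lower_prod k b > 0"
    using sqfree_tuples_pos[OF a(1)] sqfree_tuples_pos[OF b(1)] prod_pos_tuples by blast+
  have "u = v" if eq: "upper_prod k a * c ^ k = upper_prod k b * e ^ k" "lower_prod k a * d ^ k = lower_prod k b * f ^ k"
  proof -
    have m: "multiplicity p (upper_prod k a) = multiplicity p (upper_prod k b)" if p: "prime p" for p
    proof -
      have "multiplicity p (upper_prod k a) + k * multiplicity p c = multiplicity p (upper_prod k b) + k * multiplicity p e"
        using arg_cong[OF eq(1), of "multiplicity p"] multiplicity_mult_power[OF p] U a b by simp
      then have "(multiplicity p (upper_prod k a) + k * multiplicity p c) mod k
          = (multiplicity p (upper_prod k b) + k * multiplicity p e) mod k" by simp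
      then show ?thesis using sqfree_tuples_multiplicity(1)[OF a(1) p k] sqfree_tuples_multiplicity(1)[OF b(1) p k] by simp
    qed
    have ab: "a = b"
    proof
      fix i
      show "a i = b i"
      proof (cases "i \<in> {1..<k}")
        case True
        show ?thesis
        proof (rule multiplicity_eq_nat)
          fix p :: nat assume p: "prime p"
          show "multiplicity p (a i) = multiplicity p (b i)"
            using sqfree_tuples_multiplicity(2)[OF a(1) p k True] sqfree_tuples_multiplicity(2)[OF b(1) p k True] m[OF p]
            by simp
        qed (use sqfree_tuples_pos[OF a(1) True] sqfree_tuples_pos[OF b(1) True] in auto)
      next
        case False
        then show ?thesis using a b by (auto simp: sqfree_tuples_def PiE_iff extensional_def)
      qed
    qed
    have "c ^ k = e ^ k" "d ^ k = f ^ k" using eq U by (auto simp: ab)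
    then have "c = e" "d = f" using k by (auto simp: power_eq_iff_eq_base)
    then show ?thesis by (simp add: u ab)
  qed
  then show "((case u of (a, c, d) \<Rightarrow> (upper_prod k a * c ^ k, lower_prod k a * d ^ k)) =
     (case v of (a, c, d) \<Rightarrow> (upper_prod k a * c ^ k, lower_prod k a * d ^ k))) = (u = v)"
    by (auto simp: u)
next
  fix u assume "u \<in> sqfree_tuples k \<times> {0::nat<..} \<times> {0::nat<..}"
  then obtain a c d where u: "u = (a, c, d)" "a \<in> sqfree_tuples k" "c > 0" "d > 0" by auto
  have "upper_prod k a > 0" "lower_prod k a > 0"
    using sqfree_tuples_pos[OF u(2)] prod_pos_tuples by blast+
  moreover have "upper_prod k a * c ^ k * (lower_prod k a * d ^ k) = ((\<Prod>i\<in>{1..<k}. a i) * c * d) ^ k"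
    unfolding power_mult_distrib upper_lower_prod[symmetric] by (simp add: mult_ac)
  ultimately show "(case u of (a, c, d) \<Rightarrow> (upper_prod k a * c ^ k, lower_prod k a * d ^ k))
      \<in> {(x1, x2). 0 < x1 \<and> 0 < x2 \<and> is_nth_power k (x1 * x2)}"
    using u by auto
next
  fix y assume "y \<in> {(x1, x2). 0 < x1 \<and> 0 < x2 \<and> is_nth_power k (x1 * x2 :: nat)}"
  then obtain x1 x2 :: nat where y: "y = (x1, x2)" "x1 > 0" "x2 > 0" "is_nth_power k (x1 * x2)" by auto
  define S where "S = (\<lambda>i. {p \<in> prime_factors x1. multiplicity p x1 mod k = i})"
  \<comment> \<open>The entry \<open>i\<close> collects the primes whose exponent in
    \<open>x1\<close> is congruent to \<open>i\<close>; the value \<open>undefined\<close> elsewhere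
    makes the tuple extensional.\<close>
  define a where "a = (\<lambda>i. if i \<in> {1..<k} then \<Prod>p\<in>S i. p else undefined)"
  have S: "finite (S i)" "\<And>p. p \<in> S i \<Longrightarrow> prime p" for i by (auto simp: S_def)
  have apos: "a i > 0" if "i \<in> {1..<k}" for i
    using that S by (auto simp: a_def intro!: prod_pos prime_gt_0_nat)
  have mult: "multiplicity p (a i) = (if multiplicity p x1 mod k = i then 1 else 0)"
    if "i \<in> {1..<k}" "prime p" for i p
  proof -
    have "multiplicity p (a i) = multiplicity p (\<Prod>q\<in>S i. q ^ 1)" using that by (simp add: a_def)
    also have "\<dots> = (if p \<in> S i then 1 else 0)"
      by (rule multiplicity_prod_prime_powers) (use S that in auto)
    also have "p \<in> S i \<longleftrightarrow> multiplicity p x1 mod k = i"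
      using that by (cases "multiplicity p x1 = 0") (auto simp: S_def prime_factors_multiplicity)
    finally show ?thesis .
  qed
  have sum1: "(\<Sum>i\<in>{1..<k}. multiplicity p (a i)) \<le> 1" if "prime p" for p
  proof -
    have "(\<Sum>i\<in>{1..<k}. multiplicity p (a i)) = (\<Sum>i\<in>{1..<k}. if multiplicity p x1 mod k = i then 1 else 0)"
      using mult that by (intro sum.cong) auto
    then show ?thesis by (simp add: sum.delta')
  qed
  have aT: "a \<in> sqfree_tuples k"
    using apos sum1 squarefree_prod_iff[of "{1..<k}" a]
    by (auto simp: sqfree_tuples_def PiE_iff extensional_def a_def Suc_le_eq)
  have mu: "multiplicity p (upper_prod k a) = multiplicity p x1 mod k" if p: "prime p" for p
  proof (cases "multiplicity p x1 mod k = 0")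
    case True
    have "multiplicity p (upper_prod k a) = 0"
    proof (rule ccontr)
      assume n: "multiplicity p (upper_prod k a) \<noteq> 0"
      define i where "i = multiplicity p (upper_prod k a)"
      have "i \<in> {1..<k}" using n sqfree_tuples_multiplicity(1)[OF aT p k] by (auto simp: i_def)
      from sqfree_tuples_multiplicity(2)[OF aT p k this] mult[OF this p] True show False
        using n by (auto simp: i_def)
    qed
    then show ?thesis using True by simp
  next
    case False
    then have i: "multiplicity p x1 mod k \<in> {1..<k}" using k by auto
    have "(1::nat) = (if multiplicity p (upper_prod k a) = multiplicity p x1 mod k then 1 else 0)"
      using sqfree_tuples_multiplicity(2)[OF aT p k i] mult[OF i p] by (simp only: if_True refl)
    then show ?thesis by (rule contrapos_pp) simp
  qed
  have ml: "multiplicity p (lower_prod k a) = multiplicity p x2 mod k" if p: "prime p" for p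
  proof -
    have "k dvd multiplicity p x1 + multiplicity p x2"
      using y p is_nth_power_conv_multiplicity_nat[OF k, of "x1 * x2"]
      by (auto simp: prime_elem_multiplicity_mult_distrib)
    then have d: "k dvd multiplicity p x1 mod k + multiplicity p x2"
      by (simp add: mod_0_imp_dvd mod_add_left_eq dvd_eq_mod_eq_0)
    define r where "r = multiplicity p x1 mod k"
    have r: "r < k" using k by (simp add: r_def)
    obtain q where q: "r + multiplicity p x2 = k * q" using d unfolding r_def by (elim dvdE)
    have "multiplicity p x2 mod k = (k - r) mod k"
    \<comment> \<open>If \<open>q = 0\<close>, both exponents vanish modulo \<open>k\<close>, and
      \<open>(k - 0) mod k\<close> is indeed 0.\<close>
    proof (cases q)
      case 0
      then show ?thesis using q by simp
    next
      case (Suc t)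
      then have "multiplicity p x2 = k * t + (k - r)" using q r by simp
      then show ?thesis by simp
    qed
    then show ?thesis using sqfree_tuples_multiplicity(3)[OF aT p k] mu[OF p] by (simp add: r_def)
  qed
  have U: "upper_prod k a > 0" "lower_prod k a > 0" using apos prod_pos_tuples by blast+
  obtain c where c: "c > 0" "x1 = upper_prod k a * c ^ k"
    using nth_power_cofactor[OF k y(2) U(1) mu] by blast
  obtain d where d: "d > 0" "x2 = lower_prod k a * d ^ k"
    using nth_power_cofactor[OF k y(3) U(2) ml] by blast
  show "\<exists>u\<in>sqfree_tuples k \<times> {0<..} \<times> {0<..}. y = (case u of (a, c, d) \<Rightarrow> (upper_prod k a * c ^ k, lower_prod k a * d ^ k))"
    by (rule bexI[of _ "(a, c, d)"]) (use aT c d y in auto)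
qed

section \<open>The count as a sum over squarefree tuples\<close>

lemma ln_upper_lower_prod:
  assumes "\<And>i. i \<in> {1..<k} \<Longrightarrow> a i > 0"
  shows "ln (real (upper_prod k a)) = (\<Sum>i\<in>{1..<k}. real i * ln (real (a i)))"
    "ln (real (lower_prod k a)) = (\<Sum>i\<in>{1..<k}. (real k - real i) * ln (real (a i)))"
proof -
  show "ln (real (upper_prod k a)) = (\<Sum>i\<in>{1..<k}. real i * ln (real (a i)))"
    unfolding upper_prod_def of_nat_prod of_nat_power using assms
    by (subst ln_prod) (auto simp: ln_realpow)
  show "ln (real (lower_prod k a)) = (\<Sum>i\<in>{1..<k}. (real k - real i) * ln (real (a i)))"
    unfolding lower_prod_def of_nat_prod of_nat_power using assms
    by (subst ln_prod) (auto simp: ln_realpow of_nat_diff intro!: sum.cong)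
qed

lemma card_power_le:
  fixes A :: nat and H :: real
  assumes "k > 0" "A > 0" "H \<ge> 0"
  shows "{c. 0 < c \<and> real (A * c ^ k) \<le> H} = {1..nat \<lfloor>root k (H / real A)\<rfloor>}"
proof -
  have "real (A * c ^ k) \<le> H \<longleftrightarrow> c \<le> nat \<lfloor>root k (H / real A)\<rfloor>" if "c > 0" for c
  proof -
    have "real (A * c ^ k) \<le> H \<longleftrightarrow> real c ^ k \<le> H / real A"
      using assms by (simp add: field_simps)
    also have "\<dots> \<longleftrightarrow> root k (real c ^ k) \<le> root k (H / real A)" using assms by simp
    also have "root k (real c ^ k) = real c" using assms by (simp add: real_root_power_cancel)
    also have "real c \<le> root k (H / real A) \<longleftrightarrow> c \<le> nat \<lfloor>root k (H / real A)\<rfloor>"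
      using that assms by (simp add: le_nat_iff le_floor_iff)
    finally show ?thesis .
  qed
  then show ?thesis by auto
qed

text \<open>For a fixed tuple the conditions on \<open>c\<close> and \<open>d\<close> are
  independent, so the fibre is a product of two intervals. As \<open>c\<close> and \<open>d\<close>
  are at least 1, only tuples whose two products are at most \<open>H\<close> have a nonempty
  fibre.\<close>

lemma power_pair_count_eq:
  assumes k: "k > 0" and H: "H \<ge> 1"
  shows "power_pair_count k H = (\<Sum>a\<in>tuples k {1..<k} (ln H) (ln H) \<inter> {a. squarefree (\<Prod>i\<in>{1..<k}. a i)}.
     nat \<lfloor>root k (H / real (upper_prod k a))\<rfloor> * nat \<lfloor>root k (H / real (lower_prod k a))\<rfloor>)"
proof -
  define T where "T = tuples k {1..<k} (ln H) (ln H) \<inter> {a. squarefree (\<Prod>i\<in>{1..<k}. a i)}"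
  define \<psi> where "\<psi> = (\<lambda>(a, c, d). (upper_prod k a * c ^ k, lower_prod k a * d ^ k))"
  define B where "B = (\<lambda>a. {c. 0 < c \<and> real (upper_prod k a * c ^ k) \<le> H} \<times> {d. 0 < d \<and> real (lower_prod k a * d ^ k) \<le> H})"
  have bij: "bij_betw \<psi> (sqfree_tuples k \<times> {0<..} \<times> {0<..}) {(x1, x2). 0 < x1 \<and> 0 < x2 \<and> is_nth_power k (x1 * x2)}"
    unfolding \<psi>_def by (rule power_pair_bij[OF k])
  have H0: "H \<ge> 0" using H by simp
  have T: "a \<in> T \<longleftrightarrow> a \<in> sqfree_tuples k \<and> real (upper_prod k a) \<le> H \<and> real (lower_prod k a) \<le> H" for a
  proof (cases "a \<in> sqfree_tuples k")
    case True
    have pos: "a i > 0" if "i \<in> {1..<k}" for i by (rule sqfree_tuples_pos[OF True that])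
    have "ln (real (upper_prod k a)) \<le> ln H \<longleftrightarrow> real (upper_prod k a) \<le> H"
      "ln (real (lower_prod k a)) \<le> ln H \<longleftrightarrow> real (lower_prod k a) \<le> H"
      using prod_pos_tuples[of k a, OF pos] H by (auto intro!: ln_le_cancel_iff)
    moreover have e: "ln (real (upper_prod k a)) = (\<Sum>i\<in>{1..<k}. real i * ln (real (a i)))"
      "ln (real (lower_prod k a)) = (\<Sum>i\<in>{1..<k}. (real k - real i) * ln (real (a i)))"
      by (rule ln_upper_lower_prod, erule pos)+
    ultimately show ?thesis using True unfolding T_def tuples_def Int_iff mem_Collect_eq e[symmetric]
      by (simp add: sqfree_tuples_def)
  next
    case False
    then show ?thesis by (auto simp: T_def tuples_def sqfree_tuples_def)
  qed
  have le: "real A \<le> H" if "real (A * c ^ k) \<le> H" "c > 0" for A c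
  proof -
    have "A * 1 \<le> A * c ^ k" using that by (intro mult_left_mono) auto
    then have "real A \<le> real (A * c ^ k)" by (simp only: of_nat_le_iff mult_1_right)
    then show ?thesis using that by linarith
  qed
  have pre: "{u \<in> sqfree_tuples k \<times> {0<..} \<times> {0<..}. \<psi> u \<in> {(x1, x2). real x1 \<le> H \<and> real x2 \<le> H}} = Sigma T B"
    using le by (auto simp: \<psi>_def T B_def)
  have "bij_betw \<psi> {u \<in> sqfree_tuples k \<times> {0<..} \<times> {0<..}. \<psi> u \<in> {(x1, x2). real x1 \<le> H \<and> real x2 \<le> H}}
     {(x1, x2). 0 < x1 \<and> real x1 \<le> H \<and> 0 < x2 \<and> real x2 \<le> H \<and> is_nth_power k (x1 * x2)}"
  proof (rule bij_betw_subset[OF bij])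
    have im: "\<psi> ` {u \<in> S. \<psi> u \<in> Z} = \<psi> ` S \<inter> Z" for S Z by blast
    show "\<psi> ` {u \<in> sqfree_tuples k \<times> {0<..} \<times> {0<..}. \<psi> u \<in> {(x1, x2). real x1 \<le> H \<and> real x2 \<le> H}}
      = {(x1, x2). 0 < x1 \<and> real x1 \<le> H \<and> 0 < x2 \<and> real x2 \<le> H \<and> is_nth_power k (x1 * x2)}"
      unfolding im bij_betw_imp_surj_on[OF bij] by auto
  qed auto
  then have "power_pair_count k H = card (Sigma T B)"
    unfolding power_pair_count_def pre by (rule bij_betw_same_card[symmetric])
  also have "\<dots> = (\<Sum>a\<in>T. card (B a))"
  proof (rule card_SigmaI)
    show "finite T" unfolding T_def by (intro finite_Int disjI1 finite_tuples) auto
    show "\<forall>a\<in>T. finite (B a)"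
    proof
      fix a assume "a \<in> T"
      then have pos: "a i > 0" if "i \<in> {1..<k}" for i using sqfree_tuples_pos that T by blast
      have U: "upper_prod k a > 0" "lower_prod k a > 0" by (rule prod_pos_tuples, erule pos)+
      show "finite (B a)" unfolding B_def card_power_le[OF k U(1) H0]
          card_power_le[OF k U(2) H0] by simp
    qed
  qed
  also have "\<dots> = (\<Sum>a\<in>T. nat \<lfloor>root k (H / real (upper_prod k a))\<rfloor> * nat \<lfloor>root k (H / real (lower_prod k a))\<rfloor>)"
  proof (rule sum.cong[OF refl])
    fix a assume "a \<in> T"
    then have pos: "a i > 0" if "i \<in> {1..<k}" for i using sqfree_tuples_pos that T by blast
      have U: "upper_prod k a > 0" "lower_prod k a > 0" by (rule prod_pos_tuples, erule pos)+
    show "card (B a) = nat \<lfloor>root k (H / real (upper_prod k a))\<rfloor> * nat \<lfloor>root k (H / real (lower_prod k a))\<rfloor>"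
      unfolding B_def card_power_le[OF k U(1) H0]
          card_power_le[OF k U(2) H0] by (simp add: card_cartesian_product)
  qed
  finally show ?thesis unfolding T_def .
qed

section \<open>Floor errors and the asymptotic formula\<close>

text \<open>Discrete form of the integral of \<open>t powr (- s)\<close>: each summand is bounded by
  a difference of values of \<open>t powr (1 - s) / (1 - s)\<close>, and these telescope.\<close>

lemma sum_powr_le:
  fixes s :: real
  assumes "0 < s" "s < 1"
  shows "(\<Sum>n=1..M. real n powr (- s)) \<le> real M powr (1 - s) / (1 - s)"
proof (induction M)
  case (Suc M)
  have "(1 - s) * (real M + 1) powr (- s) \<le> (real M + 1) powr (1 - s) - real M powr (1 - s)"
  proof (cases "M = 0")
    case False
    \<comment> \<open>The weighted arithmetic-geometric mean inequality for \<open>M\<close> and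
      \<open>M + 1\<close> takes the place of the concavity of the power function.\<close>
    have "real M powr (1 - s) * (real M + 1) powr s \<le> (1 - s) * real M + s * (real M + 1)"
      by (rule Youngs_inequality_0) (use assms False in auto)
    then have "real M powr (1 - s) * (real M + 1) powr s * (real M + 1) powr (- s)
        \<le> ((1 - s) * real M + s * (real M + 1)) * (real M + 1) powr (- s)"
      by (rule mult_right_mono) simp
    moreover have "real M powr (1 - s) * (real M + 1) powr s * (real M + 1) powr (- s) = real M powr (1 - s)"
      by (simp add: powr_minus mult.assoc)
    moreover have "(real M + 1) * (real M + 1) powr (- s) = (real M + 1) powr (1 - s)"
      by (simp add: powr_diff powr_minus field_simps)
    moreover have "((1 - s) * real M + s * (real M + 1)) * (real M + 1) powr (- s)
      = (real M + 1) * (real M + 1) powr (- s) - (1 - s) * (real M + 1) powr (- s)"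
      by (simp add: algebra_simps)
    ultimately show ?thesis by linarith
  qed (use assms in auto)
  then have "(real M + 1) powr (- s) \<le> ((real M + 1) powr (1 - s) - real M powr (1 - s)) / (1 - s)"
    using assms by (simp add: field_simps)
  then show ?case using Suc by (simp add: diff_divide_distrib add_ac)
qed simp

lemma sum_PiE_insert:
  fixes F :: "('a \<Rightarrow> 'b) \<Rightarrow> 'c::comm_monoid_add"
  assumes "i \<notin> J"
  shows "(\<Sum>a\<in>PiE (insert i J) B. F a) = (\<Sum>b\<in>PiE J B. \<Sum>n\<in>B i. F (b(i := n)))"
proof -
  have "(\<Sum>a\<in>PiE (insert i J) B. F a) = (\<Sum>(n, b)\<in>B i \<times> PiE J B. F (b(i := n)))"
    unfolding PiE_insert_eq
    by (subst sum.reindex[OF inj_combinator[OF assms]]) (simp add: case_prod_unfold)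
  also have "\<dots> = (\<Sum>n\<in>B i. \<Sum>b\<in>PiE J B. F (b(i := n)))" by (rule sum.cartesian_product[symmetric])
  also have "\<dots> = (\<Sum>b\<in>PiE J B. \<Sum>n\<in>B i. F (b(i := n)))" by (rule sum.swap)
  finally show ?thesis .
qed

text \<open>
  Summing over the coordinate \<open>i\<close> first concentrates the sum on the face
  \<open>(\<Sum>j\<in>I. (\<kappa> - e j) * ln (a j)) = L\<close>, which has one dimension less; this saves a power of \<open>L\<close>.
\<close>

lemma sum_boundary_le:
  fixes e :: "nat \<Rightarrow> real" and \<kappa> L :: real
  assumes J: "finite J" "i \<notin> J" and e: "0 < e i" "e i < \<kappa>" and L: "L \<ge> 0"
  defines "I \<equiv> insert i J" and "N \<equiv> nat \<lfloor>exp L\<rfloor>"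
  shows "(\<Sum>a | a \<in> I \<rightarrow>\<^sub>E {1..N} \<and> (\<Sum>j\<in>I. (\<kappa> - e j) * ln (real (a j))) \<le> L.
            exp ((L - (\<Sum>j\<in>I. e j * ln (real (a j)))) / \<kappa>))
     \<le> \<kappa> / (\<kappa> - e i) * exp (2 * L / \<kappa>) * (1 + L) ^ card J"
proof -
  define s where "s = e i / \<kappa>"
  have s: "0 < s" "s < 1" and \<kappa>: "\<kappa> > 0" using e by (auto simp: s_def)
  define F where "F = (\<lambda>a::nat \<Rightarrow> nat. if (\<Sum>j\<in>I. (\<kappa> - e j) * ln (real (a j))) \<le> L
     then exp ((L - (\<Sum>j\<in>I. e j * ln (real (a j)))) / \<kappa>) else 0)"
  have S: "(\<Sum>j\<in>I. g j * ln (real ((b(i := n)) j))) = g i * ln (real n) + (\<Sum>j\<in>J. g j * ln (real (b j)))"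
    for g :: "nat \<Rightarrow> real" and b :: "nat \<Rightarrow> nat" and n
  proof -
    have "(\<Sum>j\<in>J. g j * ln (real ((b(i := n)) j))) = (\<Sum>j\<in>J. g j * ln (real (b j)))"
      using J by (intro sum.cong) auto
    then show ?thesis using J by (simp add: I_def)
  qed
  have inner: "(\<Sum>n=1..N. F (b(i := n))) \<le> \<kappa> / (\<kappa> - e i) * exp (2 * L / \<kappa>) * (\<Prod>j\<in>J. 1 / real (b j))"
    if b: "b \<in> J \<rightarrow>\<^sub>E {1..N}" for b
  proof -
    define U where "U = (\<Sum>j\<in>J. e j * ln (real (b j)))"
    define T where "T = (\<Sum>j\<in>J. (\<kappa> - e j) * ln (real (b j)))"
    define R where "R = (L - T) / (\<kappa> - e i)"
    have bpos: "b j > 0" if "j \<in> J" for j using b that by (auto simp: PiE_iff Suc_le_eq)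
    have "(\<Sum>n=1..N. F (b(i := n))) = (\<Sum>n=1..N. if ln (real n) \<le> R then exp ((L - U) / \<kappa>) * real n powr (- s) else 0)"
    proof (rule sum.cong[OF refl])
      fix n assume n: "n \<in> {1..N}"
      have "(\<kappa> - e i) * ln (real n) + T \<le> L \<longleftrightarrow> ln (real n) \<le> R"
        using e by (simp add: R_def field_simps)
      moreover have "exp ((L - (e i * ln (real n) + U)) / \<kappa>) = exp ((L - U) / \<kappa>) * real n powr (- s)"
      proof -
        have "(L - (e i * ln (real n) + U)) / \<kappa> = (L - U) / \<kappa> + - s * ln (real n)"
          using \<kappa> by (simp add: s_def field_simps)
        then show ?thesis using n by (simp add: exp_add[symmetric] powr_def)
      qed
      ultimately show "F (b(i := n)) = (if ln (real n) \<le> R then exp ((L - U) / \<kappa>) * real n powr (- s) else 0)"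
        unfolding F_def S U_def[symmetric] T_def[symmetric] by simp
    qed
    also have "\<dots> = exp ((L - U) / \<kappa>) * (\<Sum>n | n \<in> {1..N} \<and> ln (real n) \<le> R. real n powr (- s))"
      unfolding sum_distrib_left by (rule sum.inter_filter[symmetric]) simp
    also have "\<dots> \<le> exp ((L - U) / \<kappa>) * (exp (R * (1 - s)) / (1 - s))"
    proof (rule mult_left_mono)
      have "(\<Sum>n | n \<in> {1..N} \<and> ln (real n) \<le> R. real n powr (- s)) \<le> (\<Sum>n=1..nat \<lfloor>exp R\<rfloor>. real n powr (- s))"
        by (rule sum_mono2) (use le_floor_exp_iff in auto)
      also have "\<dots> \<le> real (nat \<lfloor>exp R\<rfloor>) powr (1 - s) / (1 - s)" by (rule sum_powr_le[OF s])
      also have "real (nat \<lfloor>exp R\<rfloor>) powr (1 - s) \<le> exp R powr (1 - s)"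
        using s by (intro powr_mono2) auto
      also have "exp R powr (1 - s) = exp (R * (1 - s))" by (simp add: powr_def mult.commute)
      finally show "(\<Sum>n | n \<in> {1..N} \<and> ln (real n) \<le> R. real n powr (- s)) \<le> exp (R * (1 - s)) / (1 - s)"
        using s by (simp add: divide_right_mono)
    qed simp
    also have "\<dots> = 1 / (1 - s) * exp ((L - U) / \<kappa> + R * (1 - s))" by (simp add: exp_add)
    also have "1 / (1 - s) = \<kappa> / (\<kappa> - e i)" using \<kappa> e by (simp add: s_def field_simps)
    \<comment> \<open>The sum over \<open>n\<close> is governed by its upper end
      \<open>exp R\<close>. There the exponents of each remaining \<open>b j\<close> in the two
      constraints add up to exactly \<kappa>, so \<open>b j\<close> is left with the weight
      \<open>1 / b j\<close>.\<close>
    also have "(L - U) / \<kappa> + R * (1 - s) = 2 * L / \<kappa> + - (\<Sum>j\<in>J. ln (real (b j)))"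
    proof -
      have "R * (1 - s) = (L - T) / \<kappa>" using \<kappa> e by (simp add: R_def s_def field_simps)
      moreover have "U + T = \<kappa> * (\<Sum>j\<in>J. ln (real (b j)))"
        by (simp add: U_def T_def sum.distrib[symmetric] sum_distrib_left algebra_simps)
      moreover have "(L - U) / \<kappa> + (L - T) / \<kappa> = (2 * L - (U + T)) / \<kappa>"
        by (simp add: add_divide_distrib[symmetric] algebra_simps)
      ultimately have "(L - U) / \<kappa> + R * (1 - s) = (2 * L - \<kappa> * (\<Sum>j\<in>J. ln (real (b j)))) / \<kappa>"
        by simp
      then show ?thesis using \<kappa> by (simp add: diff_divide_distrib)
    qed
    also have "exp (2 * L / \<kappa> + - (\<Sum>j\<in>J. ln (real (b j)))) = exp (2 * L / \<kappa>) * (\<Prod>j\<in>J. 1 / real (b j))"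
      unfolding exp_add exp_minus exp_sum[OF J(1)] using bpos
      by (simp add: prod_dividef inverse_eq_divide)
    finally show ?thesis by (simp only: mult.assoc)
  qed
  have fin: "finite (I \<rightarrow>\<^sub>E {1..N})" using J by (auto simp: I_def intro!: finite_PiE)
  have "(\<Sum>a | a \<in> I \<rightarrow>\<^sub>E {1..N} \<and> (\<Sum>j\<in>I. (\<kappa> - e j) * ln (real (a j))) \<le> L.
            exp ((L - (\<Sum>j\<in>I. e j * ln (real (a j)))) / \<kappa>)) = (\<Sum>a\<in>I \<rightarrow>\<^sub>E {1..N}. F a)"
    unfolding F_def by (rule sum.inter_filter[OF fin])
  also have "\<dots> = (\<Sum>b\<in>J \<rightarrow>\<^sub>E {1..N}. \<Sum>n=1..N. F (b(i := n)))"
    unfolding I_def by (rule sum_PiE_insert[OF J(2)])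
  also have "\<dots> \<le> (\<Sum>b\<in>J \<rightarrow>\<^sub>E {1..N}. \<kappa> / (\<kappa> - e i) * exp (2 * L / \<kappa>) * (\<Prod>j\<in>J. 1 / real (b j)))"
    by (rule sum_mono[OF inner])
  also have "\<dots> = \<kappa> / (\<kappa> - e i) * exp (2 * L / \<kappa>) * (\<Prod>j\<in>J. \<Sum>n=1..N. 1 / real n)"
    unfolding sum_distrib_left[symmetric] by (subst prod_sum_PiE) (use J in auto)
  also have "\<dots> \<le> \<kappa> / (\<kappa> - e i) * exp (2 * L / \<kappa>) * (\<Prod>j\<in>J. 1 + L)"
    using e L sum_inverse_le[OF L] unfolding N_def
    by (intro mult_left_mono prod_mono) (auto intro!: sum_nonneg)
  finally show ?thesis by simp
qed

section \<open>Closed form of the main constant\<close>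

lemma dd_weight_atMost:
  assumes "j \<le> k"
  shows "dd_weight {..k} j = (-1) ^ j / (fact j * fact (k - j))"
proof -
  have split: "{..k} - {j} = {..<j} \<union> {Suc j..k}" using assms by auto
  have "(\<Prod>l<j. real l - real j) = (\<Prod>l<j. - (1::real)) * (\<Prod>l<j. real (j - l))"
    unfolding prod.distrib[symmetric] by (rule prod.cong) (auto simp: of_nat_diff)
  also have "(\<Prod>l<j. real (j - l)) = fact j"
  proof -
    have "(\<Prod>l<j. real (j - l)) = (\<Prod>l\<in>{1..j}. real l)"
      by (rule prod.reindex_bij_witness[where i = "\<lambda>l. j - l" and j = "\<lambda>l. j - l"]) auto
    then show ?thesis by (simp add: fact_prod)
  qed
  finally have 1: "(\<Prod>l<j. real l - real j) = (-1) ^ j * fact j" by simp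
  have "(\<Prod>l\<in>{Suc j..k}. real l - real j) = (\<Prod>l\<in>{1..k - j}. real l)"
    by (rule prod.reindex_bij_witness[where i = "\<lambda>l. l + j" and j = "\<lambda>l. l - j"]) (use assms in \<open>auto simp: of_nat_diff\<close>)
  then have 2: "(\<Prod>l\<in>{Suc j..k}. real l - real j) = fact (k - j)" by (simp add: fact_prod)
  have "dd_weight {..k} j = 1 / ((\<Prod>l<j. real l - real j) * (\<Prod>l\<in>{Suc j..k}. real l - real j))"
    unfolding dd_weight_def split by (subst prod.union_disjoint) (auto simp: prod_dividef)
  also have "\<dots> = 1 / ((-1) ^ j * fact j * fact (k - j))" unfolding 1 2 by simp
  also have "\<dots> = (-1) ^ j / (fact j * fact (k - j))"
    by (cases "even j") auto
  finally show ?thesis .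
qed

text \<open>On the diagonal the node \<open>j = k - m\<close> has argument
  \<open>L * (2 * m - k) / k\<close>, so the truncation keeps just the \<open>m > k/2\<close>. The
  node 0, that is \<open>m = k\<close>, produces the 1 in the constant and the other surviving nodes
  produce the sum.\<close>

lemma vol_diagonal:
  assumes k: "k \<ge> 2" and L: "L \<ge> 0"
  shows "euler_const k * vol k {1..<k} L L = main_const k * L ^ (k - 1)"
proof -
  define t where "t = (\<lambda>m. (-1) ^ (k - m) / (fact m * fact (k - m)) * (max 0 (2 * real m - real k) / real k) ^ (k - 1))"
  define q where "q = (\<lambda>m. (-1) ^ (k - m) * (2 * real m - real k) ^ (k - 1) * real ((k - 1) choose m) / (real k - real m))"
  define M where "M = {m. real k / 2 < real m \<and> m \<le> k - 1}"
  have finM: "finite M" by (rule finite_subset[of _ "{..k}"]) (auto simp: M_def)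
  have ins: "insert 0 (insert k {1..<k}) = {..k}" using k by auto
  have kpos: "real k > 0" using k by simp
  have "vol k {1..<k} L L = real k / fact (k - 1) * (\<Sum>j\<le>k. (-1) ^ j / (fact j * fact (k - j)) *
        max 0 (L - real j * ((L + L) / real k)) ^ (k - 1))"
    unfolding vol_def spline_def ins using L by (simp add: dd_weight_atMost)
  also have "(\<Sum>j\<le>k. (-1) ^ j / (fact j * fact (k - j)) * max 0 (L - real j * ((L + L) / real k)) ^ (k - 1))
     = (\<Sum>j\<le>k. L ^ (k - 1) * t (k - j))"
  proof (rule sum.cong[OF refl])
    fix j assume j: "j \<in> {..k}"
    have "L - real j * ((L + L) / real k) = L * ((2 * real (k - j) - real k) / real k)"
      using j kpos by (simp add: of_nat_diff field_simps)
    also have "max 0 \<dots> = L * (max 0 (2 * real (k - j) - real k) / real k)"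
      using L kpos by (auto simp: max_def zero_le_mult_iff zero_le_divide_iff not_le mult_less_0_iff)
    finally have e: "max 0 (L - real j * ((L + L) / real k)) = L * (max 0 (2 * real (k - j) - real k) / real k)" .
    have kk: "k - (k - j) = j" using j by simp
    show "(-1) ^ j / (fact j * fact (k - j)) * max 0 (L - real j * ((L + L) / real k)) ^ (k - 1) = L ^ (k - 1) * t (k - j)"
      unfolding e t_def power_mult_distrib kk by (simp only: mult_ac)
  qed
  also have "\<dots> = L ^ (k - 1) * (\<Sum>m\<le>k. t m)"
    unfolding sum_distrib_left by (rule sum.reindex_bij_witness[where i = "\<lambda>j. k - j" and j = "\<lambda>j. k - j"]) auto
  also have "(\<Sum>m\<le>k. t m) = (\<Sum>m\<in>insert k M. t m)"
  proof (rule sum.mono_neutral_right)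
    show "\<forall>m\<in>{..k} - insert k M. t m = 0"
    proof
      fix m assume m: "m \<in> {..k} - insert k M"
      then have "2 * real m - real k \<le> 0" using k by (auto simp: M_def)
      then show "t m = 0" using k by (simp add: t_def max_def power_0_left)
    qed
  qed (auto simp: M_def)
  also have "\<dots> = t k + (\<Sum>m\<in>M. t m)" using finM k by (simp add: M_def)
  also have "t k = 1 / fact k" using kpos by (simp add: t_def)
  also have "(\<Sum>m\<in>M. t m) = (\<Sum>m\<in>M. q m / (real k ^ (k - 1) * fact (k - 1)))"
  proof (rule sum.cong[OF refl])
    fix m assume "m \<in> M"
    then have m: "m < k" "2 * real m - real k > 0" using k by (auto simp: M_def)
    \<comment> \<open>Splitting off this factor turns the factorials into the binomial coefficient
      of \<open>k - 1\<close> and leaves the denominator \<open>k - m\<close> of the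
      constant.\<close>
    have f: "fact (k - m) = (real k - real m) * fact (k - 1 - m)"
    proof -
      have "k - m = Suc (k - 1 - m)" using m by simp
      then show ?thesis using m by (simp only: fact_Suc) (simp add: of_nat_diff)
    qed
    have "real ((k - 1) choose m) = fact (k - 1) / (fact m * fact (k - 1 - m))"
      using m by (intro binomial_fact) auto
    then have "q m = (-1) ^ (k - m) * (2 * real m - real k) ^ (k - 1) * (fact (k - 1) / (fact m * fact (k - m)))"
      using m by (simp add: q_def f)
    then show "t m = q m / (real k ^ (k - 1) * fact (k - 1))"
      using m by (simp add: t_def power_divide max_def)
  qed
  also have "\<dots> = (\<Sum>m\<in>M. q m) / (real k ^ (k - 1) * fact (k - 1))" by (simp add: sum_divide_distrib)
  also have "real k / fact (k - 1) * (L ^ (k - 1) * (1 / fact k + (\<Sum>m\<in>M. q m) / (real k ^ (k - 1) * fact (k - 1))))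
     = L ^ (k - 1) * (1 / fact (k - 1) ^ 2 * (1 + 1 / real k ^ (k - 2) * (\<Sum>m\<in>M. q m)))"
  proof -
    have "fact k = real k * fact (k - 1)" using k by (simp add: fact_reduce)
    moreover have "real k ^ (k - 1) = real k * real k ^ (k - 2)"
    proof -
      have "k - 1 = Suc (k - 2)" using k by simp
      then show ?thesis by (simp only: power_Suc)
    qed
    ultimately show ?thesis using kpos by (simp add: field_simps power2_eq_square)
  qed
  finally show ?thesis unfolding main_const_def q_def[symmetric] M_def[symmetric] by simp
qed

text \<open>For fixed \<open>L\<close> only primes up to \<open>exp L\<close> can divide an entry,
  so for large \<open>N\<close> the sieved sum no longer changes and is the squarefree one.
  Meanwhile the partial Euler products converge, and the bound, being uniform in \<open>N\<close>,
  passes to the limit.\<close>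

lemma wsum_squarefree:
  assumes k: "k \<ge> 2"
  shows "\<exists>C\<ge>0. \<forall>L\<ge>0. \<bar>wsum k {1..<k} {a. squarefree (\<Prod>i\<in>{1..<k}. a i)} L L - euler_const k * vol k {1..<k} L L\<bar> \<le> C * (1 + L) ^ (k - 2)"
proof -
  define I where "I = {1..<k}"
  have I: "finite I" "I \<noteq> {}" "I \<subseteq> {1..<k}" "card I = k - 1" using k by (auto simp: I_def)
  obtain C where C: "C \<ge> 0" and b: "\<forall>N. \<forall>L\<ge>0. \<forall>\<alpha>\<le>L. \<forall>\<beta>\<le>L.
     \<bar>wsum k I (sqfree_upto N I) \<alpha> \<beta> - (\<Prod>p<N. euler_factor (card I) p) * vol k I \<alpha> \<beta>\<bar>
     \<le> C * (1 + L) ^ (card I - 1)"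
    using wsum_sqfree_upto[OF I(1-3)] by (elim exE conjE)
  show ?thesis
  proof (intro exI[of _ C] conjI allI impI C)
    fix L :: real assume L: "L \<ge> 0"
    define W where "W = wsum k I {a. squarefree (\<Prod>i\<in>I. a i)} L L"
    have eq: "wsum k I (sqfree_upto N I) L L = W" if N: "N > nat \<lfloor>exp L\<rfloor>" for N
    proof -
      have "a \<in> sqfree_upto N I \<longleftrightarrow> squarefree (\<Prod>i\<in>I. a i)" if a: "a \<in> tuples k I L L" for a
      proof -
        have n0: "(\<Prod>i\<in>I. a i) \<noteq> 0" using tuples_ge_1[OF a] I(1) by fastforce
        have "p < N" if p: "prime p" and d: "p ^ 2 dvd (\<Prod>i\<in>I. a i)" for p
        proof -
          have "p dvd (\<Prod>i\<in>I. a i)" using d by (rule dvd_trans[rotated]) simp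
          then obtain i where i: "i \<in> I" "p dvd a i" using p I(1) by (auto simp: prime_dvd_prod_iff)
          have "a i \<in> {1..nat \<lfloor>exp L\<rfloor>}" by (rule tuples_le[OF I(1,3) a i(1)]) simp
          then show ?thesis using i dvd_imp_le[of p "a i"] N by simp
        qed
        then show ?thesis unfolding sqfree_upto_def squarefree_factorial_semiring[OF n0] by blast
      qed
      then have "tuples k I L L \<inter> sqfree_upto N I = tuples k I L L \<inter> {a. squarefree (\<Prod>i\<in>I. a i)}" by blast
      then show ?thesis by (simp add: W_def wsum_def)
    qed
    have "(\<lambda>N. \<bar>W - (\<Prod>p<N. euler_factor (k - 1) p) * vol k I L L\<bar>) \<longlonglongrightarrow> \<bar>W - euler_const k * vol k I L L\<bar>"
      using k by (intro tendsto_intros euler_const_LIMSEQ) auto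
    moreover have "\<forall>\<^sub>F N in sequentially. \<bar>W - (\<Prod>p<N. euler_factor (k - 1) p) * vol k I L L\<bar> \<le> C * (1 + L) ^ (k - 2)"
      using eventually_gt_at_top[of "nat \<lfloor>exp L\<rfloor>"]
    proof eventually_elim
      case (elim N)
      have "k - 1 - 1 = k - 2" by simp
      then show ?case using b[rule_format, OF L order_refl order_refl, of N] unfolding eq[OF elim] I(4) by simp
    qed
    ultimately have "\<bar>W - euler_const k * vol k I L L\<bar> \<le> C * (1 + L) ^ (k - 2)"
      by (rule tendsto_upperbound) simp
    then show "\<bar>wsum k {1..<k} {a. squarefree (\<Prod>i\<in>{1..<k}. a i)} L L - euler_const k * vol k {1..<k} L L\<bar> \<le> C * (1 + L) ^ (k - 2)"
      by (simp add: W_def I_def)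
  qed
qed

section \<open>From the count to the reciprocal sum\<close>

lemma floor_prod_diff:
  fixes x y :: real
  assumes "x \<ge> 0" "y \<ge> 0"
  shows "\<bar>real (nat \<lfloor>x\<rfloor> * nat \<lfloor>y\<rfloor>) - x * y\<bar> \<le> x + y"
proof -
  define f g where "f = real (nat \<lfloor>x\<rfloor>)" and "g = real (nat \<lfloor>y\<rfloor>)"
  have f: "0 \<le> f" "f \<le> x" "x - f \<le> 1" and g: "0 \<le> g" "g \<le> y" "y - g \<le> 1"
    using assms by (auto simp: f_def g_def) linarith+
  have "x * y - f * g = (x - f) * y + f * (y - g)" by (simp add: algebra_simps)
  moreover have "0 \<le> (x - f) * y" "0 \<le> f * (y - g)" using f g assms by auto
  moreover have "(x - f) * y \<le> 1 * y" using f assms by (intro mult_right_mono) auto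
  moreover have "f * (y - g) \<le> x * 1" using f g by (intro mult_mono) auto
  ultimately have "\<bar>f * g - x * y\<bar> \<le> x + y" by linarith
  then show ?thesis by (simp only: f_def g_def of_nat_mult)
qed

text \<open>Without the floors the summand is exactly \<open>H powr (2 / k)\<close> over the product
  of the entries, because the exponents \<open>i\<close> and \<open>k - i\<close> add up to
  \<open>k\<close>. The floors cost at most the sum of the two roots; each root, summed over all
  tuples, is a boundary term.\<close>

lemma power_pair_count_approx:
  assumes k: "k \<ge> 2" and H: "H \<ge> 1"
  shows "\<bar>real (power_pair_count k H) - H powr (2 / real k) * wsum k {1..<k} {a. squarefree (\<Prod>i\<in>{1..<k}. a i)} (ln H) (ln H)\<bar>
    \<le> 2 * real k * H powr (2 / real k) * (1 + ln H) ^ (k - 2)"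
proof -
  define L where "L = ln H"
  have L: "L \<ge> 0" "exp L = H" using H by (auto simp: L_def)
  define I where "I = {1..<k}"
  define J where "J = {2..<k}"
  have IJ: "I = insert 1 J" using k by (auto simp: I_def J_def)
  have J: "finite J" "1 \<notin> J" "card J = k - 2" by (auto simp: J_def)
  have kpos: "real k > 0" "k > 0" using k by auto
  define Z where "Z = tuples k I L L \<inter> {a. squarefree (\<Prod>i\<in>I. a i)}"
  define x y where "x = (\<lambda>a. root k (H / real (upper_prod k a)))" and "y = (\<lambda>a. root k (H / real (lower_prod k a)))"
  define E where "E = H powr (2 / real k)"
  have E: "E = exp (2 * L / real k)" using H by (simp add: E_def powr_def L_def)
  have fin: "finite (tuples k I L L)" by (rule finite_tuples) (auto simp: I_def)
  have pos: "a i > 0" if "a \<in> tuples k I L L" "i \<in> {1..<k}" for a i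
    using tuples_ge_1[OF that(1), of i] that(2) by (simp add: I_def)
  have root_exp: "root k (H / real A) = exp ((L - ln (real A)) / real k)" if "A > 0" for A
  proof -
    have "H / real A = exp (L - ln (real A))" using that L by (simp add: exp_diff)
    also have "\<dots> = exp ((L - ln (real A)) / real k) ^ k" using kpos by (simp add: exp_of_nat_mult[symmetric])
    finally show ?thesis using kpos by (simp add: real_root_power_cancel)
  qed
  have xy: "x a = exp ((L - (\<Sum>i\<in>I. real i * ln (real (a i)))) / real k)"
     "y a = exp ((L - (\<Sum>i\<in>I. (real k - real i) * ln (real (a i)))) / real k)"
    if a: "a \<in> tuples k I L L" for a
  proof -
    have p: "a i > 0" if "i \<in> {1..<k}" for i by (rule pos[OF a that])
    have U: "upper_prod k a > 0" "lower_prod k a > 0" by (rule prod_pos_tuples, erule p)+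
    have l: "ln (real (upper_prod k a)) = (\<Sum>i\<in>{1..<k}. real i * ln (real (a i)))"
      "ln (real (lower_prod k a)) = (\<Sum>i\<in>{1..<k}. (real k - real i) * ln (real (a i)))"
      by (rule ln_upper_lower_prod, erule p)+
    show "x a = exp ((L - (\<Sum>i\<in>I. real i * ln (real (a i)))) / real k)"
      "y a = exp ((L - (\<Sum>i\<in>I. (real k - real i) * ln (real (a i)))) / real k)"
      unfolding x_def y_def root_exp[OF U(1)] root_exp[OF U(2)] l I_def by simp_all
  qed
  have prod: "x a * y a = E * (1 / (\<Prod>i\<in>I. real (a i)))" if a: "a \<in> tuples k I L L" for a
  proof -
    have "(\<Sum>i\<in>I. real i * ln (real (a i))) + (\<Sum>i\<in>I. (real k - real i) * ln (real (a i)))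
      = real k * (\<Sum>i\<in>I. ln (real (a i)))"
      by (simp add: sum.distrib[symmetric] sum_distrib_left algebra_simps)
    then have sm: "(\<Sum>i\<in>I. real i * ln (real (a i))) + (\<Sum>i\<in>I. (real k - real i) * ln (real (a i)))
      = real k * (\<Sum>i\<in>I. ln (real (a i)))" .
    have ar: "(L - A) / real k + (L - B) / real k = (2 * L - S) / real k" if "A + B = S" for A B S
      using that by (simp add: add_divide_distrib[symmetric] algebra_simps)
    have "(L - (\<Sum>i\<in>I. real i * ln (real (a i)))) / real k + (L - (\<Sum>i\<in>I. (real k - real i) * ln (real (a i)))) / real k
      = (2 * L - real k * (\<Sum>i\<in>I. ln (real (a i)))) / real k"
      by (rule ar[OF sm])
    also have "\<dots> = 2 * L / real k - (\<Sum>i\<in>I. ln (real (a i)))"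
      using kpos by (simp add: diff_divide_distrib)
    finally have "x a * y a = E * (1 / exp (\<Sum>i\<in>I. ln (real (a i))))"
      unfolding xy[OF a] exp_add[symmetric] E by (simp add: exp_diff)
    also have "exp (\<Sum>i\<in>I. ln (real (a i))) = (\<Prod>i\<in>I. real (a i))"
      using pos[OF a] by (simp add: exp_sum I_def)
    finally show ?thesis .
  qed
  have subs: "tuples k I L L \<subseteq> {a. a \<in> I \<rightarrow>\<^sub>E {1..nat \<lfloor>exp L\<rfloor>} \<and> (\<Sum>j\<in>I. (real k - e j) * ln (real (a j))) \<le> L}"
    if "e = real \<or> e = (\<lambda>i. real k - real i)" for e
    using tuples_subset_PiE[of I k L L L] that by (auto simp: tuples_def I_def)
  \<comment> \<open>The two choices of \<open>e\<close> treat the two roots. In each case the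
    constraint retained is the one belonging to the other root, and coordinate 1 is summed first;
    its factor \<open>k / (k - e 1)\<close> is at most \<open>k\<close>, whence \<open>2 * k\<close>
    for both roots together.\<close>
  have bound: "(\<Sum>a\<in>tuples k I L L. exp ((L - (\<Sum>j\<in>I. e j * ln (real (a j)))) / real k)) \<le> real k * E * (1 + L) ^ (k - 2)"
    if e: "e = real \<or> e = (\<lambda>i. real k - real i)" for e
  proof -
    have e1: "0 < e 1" "e 1 < real k" "1 \<le> real k - e 1" using e k by auto
    have "(\<Sum>a\<in>tuples k I L L. exp ((L - (\<Sum>j\<in>I. e j * ln (real (a j)))) / real k))
      \<le> (\<Sum>a | a \<in> I \<rightarrow>\<^sub>E {1..nat \<lfloor>exp L\<rfloor>} \<and> (\<Sum>j\<in>I. (real k - e j) * ln (real (a j))) \<le> L.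
            exp ((L - (\<Sum>j\<in>I. e j * ln (real (a j)))) / real k))"
    proof (rule sum_mono2[OF _ subs[OF e]])
      have "finite (I \<rightarrow>\<^sub>E {1..nat \<lfloor>exp L\<rfloor>})" by (rule finite_PiE) (auto simp: I_def)
      then show "finite {a. a \<in> I \<rightarrow>\<^sub>E {1..nat \<lfloor>exp L\<rfloor>} \<and> (\<Sum>j\<in>I. (real k - e j) * ln (real (a j))) \<le> L}"
        by (rule rev_finite_subset) blast
    qed simp
    also have "\<dots> \<le> real k / (real k - e 1) * exp (2 * L / real k) * (1 + L) ^ card J"
      unfolding IJ using sum_boundary_le[of J 1 e "real k" L, OF J(1,2) e1(1,2) L(1)] .
    also have "\<dots> \<le> real k * E * (1 + L) ^ (k - 2)"
      unfolding J(3) E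
    proof (intro mult_right_mono)
      show "real k / (real k - e 1) \<le> real k" using e1 kpos by (simp add: divide_le_eq mult_le_cancel_left1)
    qed (use L in auto)
    finally show ?thesis .
  qed
  have xy0: "x a \<ge> 0" "y a \<ge> 0" if "a \<in> tuples k I L L" for a by (simp_all add: xy[OF that])
  have "real (power_pair_count k H) - E * wsum k I {a. squarefree (\<Prod>i\<in>I. a i)} L L
    = (\<Sum>a\<in>Z. real (nat \<lfloor>x a\<rfloor> * nat \<lfloor>y a\<rfloor>) - x a * y a)"
  proof -
    have "real (power_pair_count k H) = (\<Sum>a\<in>Z. real (nat \<lfloor>x a\<rfloor> * nat \<lfloor>y a\<rfloor>))"
      unfolding power_pair_count_eq[OF kpos(2) H] Z_def x_def y_def L_def I_def by (rule of_nat_sum)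
    moreover have "E * wsum k I {a. squarefree (\<Prod>i\<in>I. a i)} L L = (\<Sum>a\<in>Z. x a * y a)"
      unfolding wsum_def Z_def[symmetric] sum_distrib_left
      by (rule sum.cong) (auto simp: Z_def prod)
    ultimately show ?thesis by (simp add: sum_subtractf)
  qed
  also have "\<bar>\<dots>\<bar> \<le> (\<Sum>a\<in>Z. x a + y a)"
    by (intro order_trans[OF sum_abs] sum_mono floor_prod_diff xy0) (auto simp: Z_def)
  also have "\<dots> \<le> (\<Sum>a\<in>tuples k I L L. x a + y a)"
    by (rule sum_mono2[OF fin]) (auto simp: Z_def xy0 intro: add_nonneg_nonneg)
  also have "\<dots> = (\<Sum>a\<in>tuples k I L L. exp ((L - (\<Sum>j\<in>I. real j * ln (real (a j)))) / real k))
      + (\<Sum>a\<in>tuples k I L L. exp ((L - (\<Sum>j\<in>I. (real k - real j) * ln (real (a j)))) / real k))"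
    unfolding sum.distrib[symmetric] by (rule sum.cong) (simp_all add: xy)
  also have "\<dots> \<le> real k * E * (1 + L) ^ (k - 2) + real k * E * (1 + L) ^ (k - 2)"
    using bound[of real] bound[of "\<lambda>i. real k - real i"] by (intro add_mono) auto
  finally show ?thesis by (simp add: E_def I_def L_def mult_ac)
qed

theorem mainTheorem1:
  fixes k :: nat
  assumes "k \<ge> 2"
  shows "(\<lambda>H. real (power_pair_count k H) - main_const k * H powr (2 / real k) * ln H ^ (k - 1))
           \<in> O[at_top](\<lambda>H. H powr (2 / real k) * ln H ^ (k - 2))"
proof -
  obtain C where C: "C \<ge> 0" and b: "\<forall>L\<ge>0. \<bar>wsum k {1..<k} {a. squarefree (\<Prod>i\<in>{1..<k}. a i)} L L
      - euler_const k * vol k {1..<k} L L\<bar> \<le> C * (1 + L) ^ (k - 2)"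
    using wsum_squarefree[OF assms] by (elim exE conjE)
  show ?thesis
  \<comment> \<open>The term \<open>2 * k\<close> pays for the floors and \<open>C\<close> for the
    reciprocal sum. The power of 2 comes from \<open>1 + ln H \<le> 2 * ln H\<close>, valid once
    \<open>H\<close> is at least \<open>exp 1\<close>.\<close>
  proof (rule bigoI[where c = "(2 * real k + C) * 2 ^ (k - 2)"])
    show "\<forall>\<^sub>F H in at_top. norm (real (power_pair_count k H) - main_const k * H powr (2 / real k) * ln H ^ (k - 1))
       \<le> (2 * real k + C) * 2 ^ (k - 2) * norm (H powr (2 / real k) * ln H ^ (k - 2))"
      using eventually_ge_at_top[of "exp 1"]
    proof eventually_elim
      case (elim H)
      have H1: "H \<ge> 1" using elim one_le_exp_iff[of 1] by linarith
      have L1: "ln H \<ge> 1" using elim H1 by (simp add: ln_ge_iff)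
      define E where "E = H powr (2 / real k)"
      define W where "W = wsum k {1..<k} {a. squarefree (\<Prod>i\<in>{1..<k}. a i)} (ln H) (ln H)"
      have E0: "E \<ge> 0" by (simp add: E_def)
      have 1: "\<bar>real (power_pair_count k H) - E * W\<bar> \<le> 2 * real k * E * (1 + ln H) ^ (k - 2)"
        unfolding E_def W_def by (rule power_pair_count_approx[OF assms H1])
      have "\<bar>W - main_const k * ln H ^ (k - 1)\<bar> \<le> C * (1 + ln H) ^ (k - 2)"
        using b[rule_format, of "ln H"] vol_diagonal[OF assms, of "ln H"] L1 by (simp add: W_def)
      then have "E * \<bar>W - main_const k * ln H ^ (k - 1)\<bar> \<le> E * (C * (1 + ln H) ^ (k - 2))"
        using E0 by (rule mult_left_mono)
      moreover have "\<bar>E * W - main_const k * E * ln H ^ (k - 1)\<bar> = E * \<bar>W - main_const k * ln H ^ (k - 1)\<bar>"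
      proof -
        have "E * W - main_const k * E * ln H ^ (k - 1) = E * (W - main_const k * ln H ^ (k - 1))"
          by (simp add: algebra_simps)
        then show ?thesis using E0 by (simp add: abs_mult)
      qed
      ultimately have "\<bar>real (power_pair_count k H) - main_const k * E * ln H ^ (k - 1)\<bar>
         \<le> 2 * real k * E * (1 + ln H) ^ (k - 2) + E * (C * (1 + ln H) ^ (k - 2))"
        using 1 by linarith
      also have "\<dots> = (2 * real k + C) * E * (1 + ln H) ^ (k - 2)" by (simp add: algebra_simps)
      also have "\<dots> \<le> (2 * real k + C) * E * (2 * ln H) ^ (k - 2)"
        using L1 C E0 by (intro mult_left_mono power_mono) auto
      also have "\<dots> = (2 * real k + C) * 2 ^ (k - 2) * (E * ln H ^ (k - 2))"
        by (simp add: power_mult_distrib)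
      also have "E * ln H ^ (k - 2) = norm (E * ln H ^ (k - 2))" using E0 L1 by simp
      finally show ?case by (simp only: E_def real_norm_def)
    qed
  qed
qed

end
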